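(* Let $\mathcal{L}>0$, $n\ge 2$, and let $\Phi:\mathbb{R}_+\to\mathbb{R}_+$ satisfy conditions (A.1), (A.2), (A.3), (A.4) stated in the context. Let $f:\mathbb{R}/\mathcal{L}\mathbb{Z}\to\mathbb{R}^n$ be a closed curve parametrized by arc-length with $\mathcal{E}_\Phi(f)<\infty$. With $\Delta f=f(s_1)-f(s_2)$, the conformal angle $\varphi(s_1,s_2)$, the angle $\psi(s_1,s_2)$ between $\tau(s_1)$ and $\tau(s_2)$, and $\Theta_\Phi$ as defined in the context, the following hold. 1. One has $$ \mathcal{E}_\Phi(f)=\mathrm{p.v.}\iint\Big\{\big(1-\Theta_\Phi(\|\Delta f\|)\big)\big(1-\cos\varphi(s_1,s_2)\big)+\Theta_\Phi(\|\Delta f\|)\big(1-\cos\psi(s_1,s_2)\big)\Big\}\frac{ds_1\,ds_2}{\Phi(\|\Delta f\|)}+2\mathcal{L}\int_{\mathcal{L}/2}^\infty\frac{dx}{\Phi(x)}, $$ where $\mathrm{p.v.}\iint=\lim_{\epsilon\to+0}\iint_{|s_1-s_2|\ge\epsilon}$ denotes integration over $(\mathbb{R}/\mathcal{L}\mathbb{Z})^2$ in the principal value sense. 2. If in addition $$\inf_{x\in(0,\mathcal{L}/2]}\left(\frac1{\Phi(x)}+\Lambda(x)\right)\ge 0,$$ then $$ \varphi_{\Phi}(s_1,s_2)=\arccos\Big\{\big(1-\Theta_\Phi(\|\Delta f\|)\big)\cos\varphi(s_1,s_2)+\Theta_\Phi(\|\Delta f\|)\cos\psi(s_1,s_2)\Big\}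 $$ is well defined for almost every $(s_1,s_2)$ (i.e. the quantity in braces lies in $[-1,1]$), and $$ \mathcal{E}_\Phi(f)=\iint_{(\mathbb{R}/\mathcal{L}\mathbb{Z})^2}\frac{1-\cos\varphi_\Phi(s_1,s_2)}{\Phi(\|\Delta f\|)}\,ds_1\,ds_2+2\mathcal{L}\int_{\mathcal{L}/2}^\infty\frac{dx}{\Phi(x)}, $$ the double integral being an ordinary (absolutely convergent) Lebesgue integral.
   Context: Notation. $\mathbb{R}_+=\{x\in\mathbb{R}: x>0\}$; $\|\cdot\|$ and $\cdot$ are the Euclidean norm and inner product of $\mathbb{R}^n$. A closed curve of length $\mathcal{L}$ parametrized by arc-length is a Lipschitz map $f:\mathbb{R}/\mathcal{L}\mathbb{Z}\to\mathbb{R}^n$ with $\|f'\|=1$ almost everywhere; $\tau=f'$ is its unit tangent vector (defined a.e.). For a function $u$ on $\mathbb{R}/\mathcal{L}\mathbb{Z}$ write $\Delta u=u(s_1)-u(s_2)$. $\mathscr{D}(f(s_1),f(s_2))$ is the distance along the curve, i.e. $\mathrm{dist}_{\mathbb{R}/\mathcal{L}\mathbb{Z}}(s_1,s_2)$, the length of the shorter arc between the two parameters; in the principal value, $|s_1-s_2|$ also means this distance. Energy. $$\mathcal{E}_\Phi(f)=\iint_{(\mathbb{R}/\mathcal{L}\mathbb{Z})^2}\left(\frac1{\Phi(\|\Delta f\|)}-\frac1{\Phi(\mathscr{D}(f(s_1),f(s_2)))}\right)ds_1\,ds_2 .$$ Functions. For $t>0$, $$\Lambda(t)=-\frac1t\int_t^\infty\frac{dx}{\Phi(x)},\qquad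 \Theta_\Phi(t)=\frac12\big(1+\Phi(t)\Lambda(t)\big).$$ Angles. $\psi(s_1,s_2)$ is the angle between $\tau(s_1)$ and $\tau(s_2)$, so $\cos\psi(s_1,s_2)=\tau(s_1)\cdot\tau(s_2)$. The conformal angle $\varphi(s_1,s_2)$: let $C_{12}$ be the circle (possibly a line) tangent to the curve at $f(s_1)$ and passing through $f(s_2)$, oriented by $\tau(s_1)$ at $f(s_1)$; let $C_{21}$ be the circle tangent to the curve at $f(s_2)$ and passing through $f(s_1)$, oriented by $\tau(s_2)$ at $f(s_2)$. Then $\varphi(s_1,s_2)$ is the angle between these two circles at $f(s_1)$ (equivalently at $f(s_2)$). In terms of $\Delta f$ and the tangents, $$\cos\varphi(s_1,s_2)=-\tau(s_1)\cdot\tau(s_2)+2\Big(\tau(s_1)\cdot\tfrac{\Delta f}{\|\Delta f\|}\Big)\Big(\tau(s_2)\cdot\tfrac{\Delta f}{\|\Delta f\|}\Big).$$ Conditions on $\Phi$ (for the given $\mathcal{L}$ and $n$). (A.1) $\Phi$ is monotonically increasing. (A.2) $\int_x^\infty \frac{dt}{\Phi(t)}<\infty$ for every $x>0$. (A.3) Let $$W_\Phi=\left\{u\in W^{1,2}(\mathbb{R}/\mathcal{L}\mathbb{Z};\mathbb{R}^n)\;:\;\iint_{(\mathbb{R}/\mathcal{L}\mathbb{Z})^2}\frac{\|\Delta u'\|^2}{\Phi(\mathrm{dist}_{\mathbb{R}/\mathcal{L}\mathbb{Z}}(s_1,s_2))}\,ds_1\,ds_2<\infty\right\}.$$ Whenever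 $f$ is a closed curve of length $\mathcal{L}$ parametrized by arc-length with $\mathcal{E}_\Phi(f)<\infty$, then $f\in W_\Phi\cap W^{1,\infty}(\mathbb{R}/\mathcal{L}\mathbb{Z})$ and $f$ is bi-Lipschitz. (A.4) Whenever $f\in W_\Phi\cap W^{1,\infty}(\mathbb{R}/\mathcal{L}\mathbb{Z})$ is bi-Lipschitz with $\|f'\|=1$ a.e., then $$\lim_{\epsilon\to+0}\epsilon\int_{\mathbb{R}/\mathcal{L}\mathbb{Z}}\big(\Lambda(\|f(s_1)-f(s_1+\epsilon)\|)-\Lambda(\epsilon)\big)\,ds_1=0,$$ $$\lim_{\epsilon\to+0}\int_{\mathbb{R}/\mathcal{L}\mathbb{Z}}\Lambda(\|f(s_1)-f(s_1+\epsilon)\|)\int_{s_1}^{s_1+\epsilon}\|f'(s_1)-f'(s_2)\|^2\,ds_2\,ds_1=0.$$ *)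

theory Defs
  imports "HOL-Analysis.Analysis"
begin

section \<open>The circle of length L\<close>

text \<open>Functions on the circle \<open>\<real>/L\<int>\<close> are \<open>L\<close>-periodic functions on the reals; integrals and
  almost-everywhere statements over the circle and over the square of the circle are taken over the
  fundamental domain, with (complete) Lebesgue measure.\<close>

abbreviation circle_measure :: "real \<Rightarrow> real measure" where
  "circle_measure L \<equiv> lebesgue_on {0..<L}"

abbreviation torus_measure :: "real \<Rightarrow> (real \<times> real) measure" where
  "torus_measure L \<equiv> lebesgue_on ({0..<L} \<times> {0..<L})"

definition circle_dist :: "real \<Rightarrow> real \<Rightarrow> real \<Rightarrow> real" where
  "circle_dist L s t = (INF k::int. \<bar>s - t - of_int k * L\<bar>)"


section \<open>Closed curves\<close>

abbreviation tangent :: "(real \<Rightarrow> 'a::euclidean_space) \<Rightarrow> real \<Rightarrow> 'a" where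
  "tangent f s \<equiv> vector_derivative f (at s)"

definition unit_speed :: "(real \<Rightarrow> 'a::euclidean_space) \<Rightarrow> bool" where
  "unit_speed f \<longleftrightarrow> (AE s in lebesgue. f differentiable (at s) \<and> norm (tangent f s) = 1)"

definition arclength_closed_curve :: "real \<Rightarrow> (real \<Rightarrow> 'a::euclidean_space) \<Rightarrow> bool" where
  "arclength_closed_curve L f \<longleftrightarrow>
     periodic_fun_simple f L \<and> (\<exists>C. C-lipschitz_on UNIV f) \<and> unit_speed f"

definition bi_lipschitz_curve :: "real \<Rightarrow> (real \<Rightarrow> 'a::euclidean_space) \<Rightarrow> bool" where
  "bi_lipschitz_curve L f \<longleftrightarrow>
     (\<exists>c>0. \<exists>C. \<forall>s t. c * circle_dist L s t \<le> dist (f s) (f t)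
                     \<and> dist (f s) (f t) \<le> C * circle_dist L s t)"


section \<open>The energy and the functions built from \<open>\<Phi>\<close>\<close>

text \<open>\<open>\<Phi>\<close> is a map from the positive reals to the positive reals; its values at other arguments
  are irrelevant. For an arc-length parametrized closed curve the parameter pairs with
  \<open>f s1 = f s2\<close> form a null set, because a level set of positive measure would carry a zero
  derivative at its density points. When \<open>\<Phi>\<close> is monotone and \<open>f\<close> is parametrized by arc-length, the
  integrand of the energy is nonnegative at all other pairs, as \<open>\<parallel>f s1 - f s2\<parallel>\<close> is at most the
  distance along the curve; the cast to \<^typ>\<open>ennreal\<close> therefore truncates nothing.\<close>

definition energy :: "(real \<Rightarrow> real) \<Rightarrow> real \<Rightarrow> (real \<Rightarrow> 'a::euclidean_space) \<Rightarrow> ennreal" where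
  "energy \<Phi> L f =
     (\<integral>\<^sup>+ (s1, s2). ennreal (1 / \<Phi> (norm (f s1 - f s2)) - 1 / \<Phi> (circle_dist L s1 s2))
        \<partial>torus_measure L)"

definition tail_integral :: "(real \<Rightarrow> real) \<Rightarrow> real \<Rightarrow> real" where
  "tail_integral \<Phi> t = (LINT x:{t..}|lebesgue. 1 / \<Phi> x)"

definition Lam :: "(real \<Rightarrow> real) \<Rightarrow> real \<Rightarrow> real" where
  "Lam \<Phi> t = - (1 / t) * tail_integral \<Phi> t"

definition Theta :: "(real \<Rightarrow> real) \<Rightarrow> real \<Rightarrow> real" where
  "Theta \<Phi> t = 1 / 2 * (1 + \<Phi> t * Lam \<Phi> t)"


section \<open>Sobolev spaces on the circle\<close>

definition L2_circle :: "real \<Rightarrow> (real \<Rightarrow> 'a::euclidean_space) \<Rightarrow> bool" where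
  "L2_circle L u \<longleftrightarrow> periodic_fun_simple u L \<and> u \<in> borel_measurable lebesgue
     \<and> integrable (circle_measure L) (\<lambda>s. (norm (u s))\<^sup>2)"

definition Linf_circle :: "real \<Rightarrow> (real \<Rightarrow> 'a::euclidean_space) \<Rightarrow> bool" where
  "Linf_circle L u \<longleftrightarrow> periodic_fun_simple u L \<and> u \<in> borel_measurable lebesgue
     \<and> (\<exists>C. AE s in lebesgue. norm (u s) \<le> C)"

definition test_function :: "real \<Rightarrow> (real \<Rightarrow> real) \<Rightarrow> bool" where
  "test_function L \<eta> \<longleftrightarrow> periodic_fun_simple \<eta> L
     \<and> (\<forall>k x. ((deriv ^^ k) \<eta>) field_differentiable (at x))"

definition weak_derivative ::
  "real \<Rightarrow> (real \<Rightarrow> 'a::euclidean_space) \<Rightarrow> (real \<Rightarrow> 'a) \<Rightarrow> bool" where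
  "weak_derivative L u v \<longleftrightarrow>
     (\<forall>\<eta>. test_function L \<eta> \<longrightarrow>
        (LINT s|circle_measure L. deriv \<eta> s *\<^sub>R u s) = - (LINT s|circle_measure L. \<eta> s *\<^sub>R v s))"

definition W1inf :: "real \<Rightarrow> (real \<Rightarrow> 'a::euclidean_space) \<Rightarrow> bool" where
  "W1inf L u \<longleftrightarrow> Linf_circle L u \<and> (\<exists>v. Linf_circle L v \<and> weak_derivative L u v)"

text \<open>The weak derivative is unique up to null sets, so the existential quantifier below does not
  depend on the choice of \<open>v\<close>.\<close>

definition W_Phi :: "(real \<Rightarrow> real) \<Rightarrow> real \<Rightarrow> (real \<Rightarrow> 'a::euclidean_space) \<Rightarrow> bool" where
  "W_Phi \<Phi> L u \<longleftrightarrow> L2_circle L u \<and>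
     (\<exists>v. L2_circle L v \<and> weak_derivative L u v \<and>
        (\<integral>\<^sup>+ (s1, s2). ennreal ((norm (v s1 - v s2))\<^sup>2 / \<Phi> (circle_dist L s1 s2))
           \<partial>torus_measure L) < \<infinity>)"


section \<open>Angles\<close>

definition vec_angle :: "'a::real_inner \<Rightarrow> 'a \<Rightarrow> real" where
  "vec_angle x y = arccos (x \<bullet> y / (norm x * norm y))"

text \<open>Oriented circles, including straight lines, given by a parametrization with unit speed.\<close>

definition oriented_circle :: "(real \<Rightarrow> 'a::real_inner) \<Rightarrow> bool" where
  "oriented_circle C \<longleftrightarrow>
     (\<exists>p v. norm v = 1 \<and> C = (\<lambda>t. p + t *\<^sub>R v)) \<or>
     (\<exists>m r a b. r > 0 \<and> norm a = 1 \<and> norm b = 1 \<and> a \<bullet> b = 0 \<and>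
        C = (\<lambda>t. m + r *\<^sub>R (cos (t / r) *\<^sub>R a + sin (t / r) *\<^sub>R b)))"

text \<open>\<open>C\<close> is the circle through \<open>p\<close> and \<open>q\<close> that is tangent at \<open>p\<close> to \<open>v\<close> and oriented by \<open>v\<close>.\<close>

definition tangent_circle :: "(real \<Rightarrow> 'a::real_inner) \<Rightarrow> 'a \<Rightarrow> 'a \<Rightarrow> 'a \<Rightarrow> bool" where
  "tangent_circle C p v q \<longleftrightarrow> oriented_circle C
     \<and> (\<exists>t. C t = p \<and> (C has_vector_derivative v) (at t)) \<and> q \<in> range C"

text \<open>The angle at \<open>p1\<close> between the circle tangent to \<open>v1\<close> at \<open>p1\<close> through \<open>p2\<close> and the circle
  tangent to \<open>v2\<close> at \<open>p2\<close> through \<open>p1\<close>. It is unique when \<open>v1\<close>, \<open>v2\<close> are unit vectors and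
  \<open>p1 \<noteq> p2\<close>; see \<open>cos_conformal_angle\<close> below.\<close>

definition conformal_angle :: "'a::real_inner \<Rightarrow> 'a \<Rightarrow> 'a \<Rightarrow> 'a \<Rightarrow> real" where
  "conformal_angle p1 v1 p2 v2 =
     (THE \<alpha>. \<exists>C12 C21 t t'.
        tangent_circle C12 p1 v1 p2 \<and> tangent_circle C21 p2 v2 p1 \<and>
        C12 t = p1 \<and> C21 t' = p1 \<and>
        \<alpha> = vec_angle (vector_derivative C12 (at t)) (vector_derivative C21 (at t')))"

definition phi_angle :: "(real \<Rightarrow> 'a::euclidean_space) \<Rightarrow> real \<Rightarrow> real \<Rightarrow> real" where
  "phi_angle f s1 s2 = conformal_angle (f s1) (tangent f s1) (f s2) (tangent f s2)"

definition psi_angle :: "(real \<Rightarrow> 'a::euclidean_space) \<Rightarrow> real \<Rightarrow> real \<Rightarrow> real" where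
  "psi_angle f s1 s2 = vec_angle (tangent f s1) (tangent f s2)"

definition phi_Phi_cos ::
  "(real \<Rightarrow> real) \<Rightarrow> (real \<Rightarrow> 'a::euclidean_space) \<Rightarrow> real \<Rightarrow> real \<Rightarrow> real" where
  "phi_Phi_cos \<Phi> f s1 s2 =
     (1 - Theta \<Phi> (norm (f s1 - f s2))) * cos (phi_angle f s1 s2)
     + Theta \<Phi> (norm (f s1 - f s2)) * cos (psi_angle f s1 s2)"

definition phi_Phi ::
  "(real \<Rightarrow> real) \<Rightarrow> (real \<Rightarrow> 'a::euclidean_space) \<Rightarrow> real \<Rightarrow> real \<Rightarrow> real" where
  "phi_Phi \<Phi> f s1 s2 = arccos (phi_Phi_cos \<Phi> f s1 s2)"


section \<open>Principal values\<close>

definition off_diagonal :: "real \<Rightarrow> real \<Rightarrow> (real \<times> real) set" where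
  "off_diagonal L \<epsilon> = {(s1, s2). \<epsilon> \<le> circle_dist L s1 s2}"

definition has_pv_integral :: "real \<Rightarrow> (real \<times> real \<Rightarrow> real) \<Rightarrow> real \<Rightarrow> bool" where
  "has_pv_integral L g V \<longleftrightarrow>
     (\<forall>\<epsilon>>0. set_integrable (torus_measure L) (off_diagonal L \<epsilon>) g) \<and>
     ((\<lambda>\<epsilon>. LINT p:off_diagonal L \<epsilon>|torus_measure L. g p) \<longlongrightarrow> V) (at_right 0)"


section \<open>The formula for the conformal angle\<close>

lemma oriented_circle_line_deriv:
  "((\<lambda>t. p + t *\<^sub>R v) has_vector_derivative v) (at t)"
  by (auto intro!: derivative_eq_intros)

lemma oriented_circle_circle_deriv:
  fixes a b m :: "'a::real_inner"
  assumes "r > 0"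
  shows "((\<lambda>t. m + r *\<^sub>R (cos (t / r) *\<^sub>R a + sin (t / r) *\<^sub>R b)) has_vector_derivative
           (- sin (t / r) *\<^sub>R a + cos (t / r) *\<^sub>R b)) (at t)"
proof -
  have c: "((\<lambda>t. cos (t / r) *\<^sub>R a) has_vector_derivative ((- sin (t / r) / r) *\<^sub>R a)) (at t)"
    by (rule has_vector_derivative_scaleR[where g' = 0, simplified])
      (use assms in \<open>auto intro!: derivative_eq_intros\<close>)
  have s: "((\<lambda>t. sin (t / r) *\<^sub>R b) has_vector_derivative ((cos (t / r) / r) *\<^sub>R b)) (at t)"
    by (rule has_vector_derivative_scaleR[where g' = 0, simplified])
      (use assms in \<open>auto intro!: derivative_eq_intros\<close>)
  have "((\<lambda>t. m + r *\<^sub>R (cos (t / r) *\<^sub>R a + sin (t / r) *\<^sub>R b)) has_vector_derivative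
      (0 + r *\<^sub>R ((- sin (t / r) / r) *\<^sub>R a + (cos (t / r) / r) *\<^sub>R b))) (at t)"
    by (intro has_vector_derivative_add has_vector_derivative_const
        bounded_linear.has_vector_derivative[OF bounded_linear_scaleR_right] c s)
  moreover have "0 + r *\<^sub>R ((- sin (t / r) / r) *\<^sub>R a + (cos (t / r) / r) *\<^sub>R b)
      = - sin (t / r) *\<^sub>R a + cos (t / r) *\<^sub>R b"
    using assms by (simp add: scaleR_right_diff_distrib)
  ultimately show ?thesis by simp
qed

text \<open>Chord-tangent relation: the tangent at \<open>q\<close> is the reflection of the tangent at \<open>p\<close> in the
  chord.\<close>

lemma oriented_circle_tangents:
  fixes C :: "real \<Rightarrow> 'a::real_inner"
  assumes C: "oriented_circle C" and t: "(C has_vector_derivative v) (at t)"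
    and t': "(C has_vector_derivative w) (at t')"
  defines "d \<equiv> C t - C t'"
  shows "norm v = 1" "norm w = 1"
    "(norm d)\<^sup>2 *\<^sub>R w = (2 * (v \<bullet> d)) *\<^sub>R d - (norm d)\<^sup>2 *\<^sub>R v \<and> (C t = C t' \<longrightarrow> v = w)"
proof -
  have "norm v = 1 \<and> norm w = 1 \<and> 
    ((norm d)\<^sup>2 *\<^sub>R w = (2 * (v \<bullet> d)) *\<^sub>R d - (norm d)\<^sup>2 *\<^sub>R v \<and> (C t = C t' \<longrightarrow> v = w))"
    using C unfolding oriented_circle_def
  proof (elim disjE exE conjE)
    fix p u assume u: "norm u = 1" and C: "C = (\<lambda>t. p + t *\<^sub>R u)"
    have v: "v = u" "w = u"
      using t t' oriented_circle_line_deriv vector_derivative_unique_at unfolding C by blast+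
    have d: "d = (t - t') *\<^sub>R u" by (simp add: d_def C algebra_simps)
    have "(u \<bullet> u) = 1" using u by (simp add: dot_square_norm)
    moreover have "(norm d)\<^sup>2 = (t - t')\<^sup>2" using u by (simp add: d power_mult_distrib)
    ultimately show ?thesis using u unfolding v
      by (simp add: d power2_eq_square flip: scaleR_left_diff_distrib)
  next
    fix m r a b
    assume r: "r > 0" and a: "norm a = 1" and b: "norm b = 1" and ab: "a \<bullet> b = 0"
      and C: "C = (\<lambda>t. m + r *\<^sub>R (cos (t / r) *\<^sub>R a + sin (t / r) *\<^sub>R b))"
    define x y where "x = t / r" and "y = t' / r"
    have aa: "a \<bullet> a = 1" "b \<bullet> b = 1" "b \<bullet> a = 0" "a \<bullet> b = 0"
      using a b ab by (simp_all add: dot_square_norm inner_commute)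
    have v: "v = - sin x *\<^sub>R a + cos x *\<^sub>R b"
      using t oriented_circle_circle_deriv[OF r] vector_derivative_unique_at
      unfolding C x_def by blast
    have w: "w = - sin y *\<^sub>R a + cos y *\<^sub>R b"
      using t' oriented_circle_circle_deriv[OF r] vector_derivative_unique_at
      unfolding C y_def by blast
    have d: "d = (r * (cos x - cos y)) *\<^sub>R a + (r * (sin x - sin y)) *\<^sub>R b"
      by (simp add: d_def C x_def y_def algebra_simps)
    have nv: "v \<bullet> v = 1" "w \<bullet> w = 1"
      by (simp_all add: v w inner_add_left inner_add_right inner_diff_left inner_diff_right aa
          flip: power2_eq_square)
    have dd: "(norm d)\<^sup>2 = 2 * r\<^sup>2 * (1 - cos (x - y))"
    proof -
      have "(norm d)\<^sup>2 = r\<^sup>2 * ((cos x - cos y)\<^sup>2 + (sin x - sin y)\<^sup>2)"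
        unfolding power2_norm_eq_inner d
        by (simp only: inner_add_left inner_add_right inner_scaleR_left inner_scaleR_right aa) algebra
      also have "(cos x - cos y)\<^sup>2 + (sin x - sin y)\<^sup>2
          = (sin x ^ 2 + cos x ^ 2) + (sin y ^ 2 + cos y ^ 2) - 2 * (cos x * cos y + sin x * sin y)"
        by algebra
      finally show ?thesis by (simp only: sin_cos_squared_add cos_diff) (simp add: algebra_simps)
    qed
    have vd: "v \<bullet> d = r * sin (x - y)"
      unfolding v d by (simp add: inner_add_left inner_add_right inner_diff_left aa sin_diff algebra_simps)
    define X where "X = x - y"
    have x: "x = y + X" by (simp add: X_def)
    have sc: "sin X ^ 2 = 1 - cos X ^ 2" "sin X * sin X = 1 - cos X * cos X" 
      by (simp_all add: sin_squared_eq flip: power2_eq_square)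
    have A: "2 * r\<^sup>2 * (1 - cos X) * (- sin y) =
        2 * (r * sin X) * (r * (cos x - cos y)) - 2 * r\<^sup>2 * (1 - cos X) * (- sin x)"
    proof -
      have "sin X * (cos x - cos y) + (1 - cos X) * sin x + (1 - cos X) * sin y =
         sin X * (cos y * cos X - sin y * sin X - cos y) 
          + (1 - cos X) * (sin y * cos X + cos y * sin X) + (1 - cos X) * sin y"
        by (simp add: x sin_add cos_add)
      also have "\<dots> = sin y * (1 - cos X * cos X - sin X * sin X)" by algebra
      finally have "sin X * (cos x - cos y) + (1 - cos X) * sin x + (1 - cos X) * sin y = 0"
        by (simp add: sc)
      then have "2 * r\<^sup>2 * (sin X * (cos x - cos y) + (1 - cos X) * sin x + (1 - cos X) * sin y) = 0"
        by simp
      then show ?thesis by algebra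
    qed
    have B: "2 * r\<^sup>2 * (1 - cos X) * cos y =
        2 * (r * sin X) * (r * (sin x - sin y)) - 2 * r\<^sup>2 * (1 - cos X) * cos x"
    proof -
      have "sin X * (sin x - sin y) - (1 - cos X) * cos x - (1 - cos X) * cos y =
         sin X * (sin y * cos X + cos y * sin X - sin y) 
          - (1 - cos X) * (cos y * cos X - sin y * sin X) - (1 - cos X) * cos y"
        by (simp add: x sin_add cos_add)
      also have "\<dots> = cos y * (cos X * cos X + sin X * sin X - 1)" by algebra
      finally have "sin X * (sin x - sin y) - (1 - cos X) * cos x - (1 - cos X) * cos y = 0"
        by (simp add: sc)
      then have "2 * r\<^sup>2 * (sin X * (sin x - sin y) - (1 - cos X) * cos x - (1 - cos X) * cos y) = 0"
        by simp
      then show ?thesis by algebra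
    qed
    have "(norm d)\<^sup>2 *\<^sub>R w = (2 * r\<^sup>2 * (1 - cos X) * (- sin y)) *\<^sub>R a
        + (2 * r\<^sup>2 * (1 - cos X) * cos y) *\<^sub>R b"
      unfolding dd w X_def[symmetric] by (simp add: scaleR_right_distrib scaleR_right_diff_distrib)
    also have "\<dots> = (2 * (v \<bullet> d)) *\<^sub>R d - (norm d)\<^sup>2 *\<^sub>R v"
      unfolding A B vd dd X_def[symmetric] unfolding v d
      by (simp only: scaleR_left_diff_distrib scaleR_right_distrib scaleR_scaleR)
        (simp add: algebra_simps)
    finally have main: "(norm d)\<^sup>2 *\<^sub>R w = (2 * (v \<bullet> d)) *\<^sub>R d - (norm d)\<^sup>2 *\<^sub>R v" .
    have "v = w" if "C t = C t'"
    proof -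
      have 0: "r * (cos x - cos y) = 0" "r * (sin x - sin y) = 0"
      proof -
        have "d = 0" using that by (simp add: d_def)
        then have "d \<bullet> a = 0" "d \<bullet> b = 0" by simp_all
        then show "r * (cos x - cos y) = 0" "r * (sin x - sin y) = 0"
          unfolding d by (simp_all only: inner_add_left inner_scaleR_left aa)
      qed
      then show ?thesis using r by (simp add: v w)
    qed
    then show ?thesis using nv main by (simp add: norm_eq_1)
  qed
  then show "norm v = 1" "norm w = 1"
    "(norm d)\<^sup>2 *\<^sub>R w = (2 * (v \<bullet> d)) *\<^sub>R d - (norm d)\<^sup>2 *\<^sub>R v \<and> (C t = C t' \<longrightarrow> v = w)" by auto
qed

lemma tangent_circle_exists:
  fixes p q v :: "'a::real_inner"
  assumes v: "norm v = 1" and pq: "p \<noteq> q"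
  shows "\<exists>C. tangent_circle C p v q"
proof -
  define d where "d = q - p"
  define \<alpha> where "\<alpha> = d \<bullet> v"
  define n where "n = d - \<alpha> *\<^sub>R v"
  define \<beta> where "\<beta> = norm n"
  have vv: "v \<bullet> v = 1" using v by (simp add: dot_square_norm)
  show ?thesis
  proof (cases "n = 0")
    case True
    then have q: "q = p + \<alpha> *\<^sub>R v" by (simp add: n_def d_def algebra_simps)
    have "tangent_circle (\<lambda>t. p + t *\<^sub>R v) p v q"
      unfolding tangent_circle_def oriented_circle_def
    proof (intro conjI)
      show "\<exists>t. p + t *\<^sub>R v = p \<and> ((\<lambda>t. p + t *\<^sub>R v) has_vector_derivative v) (at t)"
        by (intro exI[of _ 0]) (simp add: oriented_circle_line_deriv)
    qed (use v q in auto)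
    then show ?thesis by blast
  next
    case False
    then have \<beta>: "\<beta> > 0" by (simp add: \<beta>_def)
    define \<nu> where "\<nu> = (1 / \<beta>) *\<^sub>R n"
    define r where "r = (\<alpha>\<^sup>2 + \<beta>\<^sup>2) / (2 * \<beta>)"
    have r: "r > 0" using \<beta> by (auto simp: r_def intro!: divide_pos_pos add_nonneg_pos)
    have n\<nu>: "norm \<nu> = 1" using \<beta> by (simp add: \<nu>_def \<beta>_def)
    have "n \<bullet> v = 0" by (simp add: n_def inner_diff_left vv \<alpha>_def)
    then have \<nu>v: "\<nu> \<bullet> v = 0" by (simp add: \<nu>_def)
    have q: "q = p + \<alpha> *\<^sub>R v + \<beta> *\<^sub>R \<nu>"
      using \<beta> by (simp add: \<nu>_def) (simp add: n_def d_def algebra_simps)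
    have "(1 - \<beta> / r)\<^sup>2 + (\<alpha> / r)\<^sup>2 = 1"
    proof -
      have "2 * \<beta> * r = \<alpha>\<^sup>2 + \<beta>\<^sup>2" using \<beta> by (simp add: r_def)
      then have "(r - \<beta>)\<^sup>2 + \<alpha>\<^sup>2 = r\<^sup>2" by (simp add: power2_eq_square algebra_simps)
      then have "((r - \<beta>)\<^sup>2 + \<alpha>\<^sup>2) / r\<^sup>2 = 1" using r by simp
      moreover have "1 - \<beta> / r = (r - \<beta>) / r" using r by (simp add: field_simps)
      ultimately show ?thesis by (simp add: power_divide add_divide_distrib)
    qed
    then obtain \<theta> where \<theta>: "1 - \<beta> / r = cos \<theta>" "\<alpha> / r = sin \<theta>"
      using sincos_total_2pi by metis
    define C where
      "C = (\<lambda>t. (p + r *\<^sub>R \<nu>) + r *\<^sub>R (cos (t / r) *\<^sub>R (- \<nu>) + sin (t / r) *\<^sub>R v))"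
    have C0: "C 0 = p" by (simp add: C_def)
    have "C (r * \<theta>) = p + (r * (1 - cos \<theta>)) *\<^sub>R \<nu> + (r * sin \<theta>) *\<^sub>R v"
      using r by (simp add: C_def algebra_simps)
    also have "\<dots> = q" using r unfolding q by (simp flip: \<theta>)
    finally have Cq: "q \<in> range C" by blast
    have "(C has_vector_derivative v) (at 0)"
      using oriented_circle_circle_deriv[OF r, of "p + r *\<^sub>R \<nu>" "- \<nu>" v 0] by (simp add: C_def)
    moreover have "oriented_circle C"
      unfolding oriented_circle_def
    proof (intro disjI2 exI conjI)
      show "C = (\<lambda>t. (p + r *\<^sub>R \<nu>) + r *\<^sub>R (cos (t / r) *\<^sub>R (- \<nu>) + sin (t / r) *\<^sub>R v))"
        by (fact C_def)
    qed (use r v n\<nu> \<nu>v in simp_all)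
    ultimately show ?thesis using C0 Cq unfolding tangent_circle_def by blast
  qed
qed

lemma oriented_circle_differentiable:
  assumes "oriented_circle C"
  shows "(C has_vector_derivative vector_derivative C (at t)) (at t)"
proof -
  have "\<exists>w. (C has_vector_derivative w) (at t)"
    using assms oriented_circle_line_deriv oriented_circle_circle_deriv
    unfolding oriented_circle_def by blast
  then show ?thesis by (metis vector_derivative_at)
qed

lemma tangent_circle_vector_derivative:
  fixes p q v :: "'a::real_inner"
  assumes C: "tangent_circle C p v q"
  shows "C t = p \<Longrightarrow> vector_derivative C (at t) = v"
    and "C t = q \<Longrightarrow> p \<noteq> q \<Longrightarrow>
      vector_derivative C (at t) = (2 * (v \<bullet> (p - q)) / (norm (p - q))\<^sup>2) *\<^sub>R (p - q) - v"
proof -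
  obtain t0 where t0: "C t0 = p" "(C has_vector_derivative v) (at t0)" and o: "oriented_circle C"
    using C unfolding tangent_circle_def by blast
  note * = oriented_circle_tangents(3)[OF o t0(2) oriented_circle_differentiable[OF o, of t]]
  show "vector_derivative C (at t) = v" if "C t = p" using * that t0 by simp
  show "vector_derivative C (at t) = (2 * (v \<bullet> (p - q)) / (norm (p - q))\<^sup>2) *\<^sub>R (p - q) - v"
    if "C t = q" "p \<noteq> q"
  proof -
    let ?N = "(norm (p - q))\<^sup>2"
    have "?N *\<^sub>R vector_derivative C (at t) = (2 * (v \<bullet> (p - q))) *\<^sub>R (p - q) - ?N *\<^sub>R v"
      using * that t0 by simp
    then have "(1 / ?N) *\<^sub>R (?N *\<^sub>R vector_derivative C (at t))
        = (1 / ?N) *\<^sub>R ((2 * (v \<bullet> (p - q))) *\<^sub>R (p - q) - ?N *\<^sub>R v)" by simp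
    then show ?thesis using that by (simp add: scaleR_right_diff_distrib)
  qed
qed

lemma cos_vec_angle: "norm x = 1 \<Longrightarrow> norm y = 1 \<Longrightarrow> cos (vec_angle x y) = x \<bullet> y"
  unfolding vec_angle_def using Cauchy_Schwarz_ineq2[of x y]
  by (simp add: abs_le_iff cos_arccos)

lemma cos_conformal_angle:
  fixes p1 p2 v1 v2 :: "'a::real_inner"
  assumes v: "norm v1 = 1" "norm v2 = 1" and p: "p1 \<noteq> p2"
  defines "e \<equiv> (1 / norm (p1 - p2)) *\<^sub>R (p1 - p2)"
  shows "cos (conformal_angle p1 v1 p2 v2) = - (v1 \<bullet> v2) + 2 * (v1 \<bullet> e) * (v2 \<bullet> e)"
proof -
  define d where "d = p2 - p1"
  define w where "w = (2 * (v2 \<bullet> d) / (norm d)\<^sup>2) *\<^sub>R d - v2"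
  obtain C12 C21 where C: "tangent_circle C12 p1 v1 p2" "tangent_circle C21 p2 v2 p1"
    using tangent_circle_exists v p by metis
  obtain t where t: "C12 t = p1" using C(1) unfolding tangent_circle_def by blast
  obtain t' where t': "C21 t' = p1" using C(2) unfolding tangent_circle_def by blast
  have d1: "vector_derivative D (at s) = v1" if "tangent_circle D p1 v1 p2" "D s = p1" for D s
    using tangent_circle_vector_derivative(1) that by blast
  have d2: "vector_derivative D (at s) = w" if "tangent_circle D p2 v2 p1" "D s = p1" for D s
    using tangent_circle_vector_derivative(2)[OF that] p unfolding w_def d_def by simp
  have "conformal_angle p1 v1 p2 v2 = vec_angle v1 w"
    unfolding conformal_angle_def
  proof (rule the_equality)
    show "\<exists>C12 C21 t t'. tangent_circle C12 p1 v1 p2 \<and> tangent_circle C21 p2 v2 p1 \<and>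
        C12 t = p1 \<and> C21 t' = p1 \<and>
        vec_angle v1 w = vec_angle (vector_derivative C12 (at t)) (vector_derivative C21 (at t'))"
      using C t t' d1[OF C(1) t] d2[OF C(2) t'] by metis
  qed (use d1 d2 in auto)
  moreover have "norm w = 1"
  proof -
    obtain t2 where t2: "(C21 has_vector_derivative v2) (at t2)" and o: "oriented_circle C21"
      using C(2) unfolding tangent_circle_def by blast
    show ?thesis
      using oriented_circle_tangents(2)[OF o t2 oriented_circle_differentiable[OF o, of t']]
        d2[OF C(2) t'] by simp
  qed
  ultimately have "cos (conformal_angle p1 v1 p2 v2) = v1 \<bullet> w" using cos_vec_angle v by metis
  also have "\<dots> = - (v1 \<bullet> v2) + 2 * (v1 \<bullet> e) * (v2 \<bullet> e)"
  proof -
    have de: "d = - norm d *\<^sub>R e" "norm d \<noteq> 0"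
      using p by (simp_all add: d_def e_def norm_minus_commute)
    have "v1 \<bullet> d = - norm d * (v1 \<bullet> e)" "v2 \<bullet> d = - norm d * (v2 \<bullet> e)"
      by (subst de(1), simp)+
    then show ?thesis using de(2) 
      by (simp add: w_def inner_diff_right power2_eq_square)
  qed
  finally show ?thesis .
qed

end

theory Submission
  imports Defs
begin

text \<open>Write \<open>r = \<parallel>f s - f t\<parallel>\<close>. Expressing the two cosines by the tangents, the integrand becomes
  \<open>1 / \<Phi> r + d/dt (\<Lambda> r (f s - f t) \<bullet> \<tau> s)\<close>, because \<open>r \<Lambda>' r = 1 / \<Phi> r - \<Lambda> r\<close>. Only first derivatives of
  \<open>f\<close> enter, so for fixed \<open>s\<close> the fundamental theorem of calculus for Lipschitz functions applies on
  \<open>[s + \<epsilon>, s + L - \<epsilon>]\<close>. Since \<open>(f (s + \<epsilon>) - f s) \<bullet> \<tau> s\<close> differs from \<open>\<epsilon>\<close> by half the integral of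
  \<open>\<parallel>\<tau> s - \<tau> t\<parallel>\<^sup>2\<close> over \<open>[s, s + \<epsilon>]\<close>, condition (A.4) for \<open>f\<close> and for the reversed curve shows that each
  boundary term is \<open>- L \<integral>\<^sub>\<epsilon>\<^sup>\<infinity> dx / \<Phi> x + o(1)\<close>. The integral of \<open>1 / \<Phi> (dist s t)\<close> off the diagonal is
  \<open>2 L \<integral> dx / \<Phi> x\<close> over \<open>[\<epsilon>, L / 2]\<close>; its divergent part cancels the boundary terms. Under the extra
  hypothesis \<open>\<Theta>\<close> takes values in \<open>[0, 1]\<close>, the integrand is nonnegative and monotone convergence
  removes the principal value.\<close>

section \<open>Lipschitz functions and integrals\<close>

text \<open>Difference quotients of a Lipschitz function are bounded by its Lipschitz constant and
  converge almost everywhere to \<open>g\<close>, so by dominated convergence their integrals tend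
  to that of \<open>g\<close>. After a shift of variable the same integrals are differences of
  averages of \<open>F\<close> near the two end points, which tend to
  \<open>F b - F a\<close>.\<close>

lemma has_integral_lipschitz_derivative:
  fixes F g :: "real \<Rightarrow> real"
  assumes ab: "a \<le> b" and lip: "K-lipschitz_on {a..b} F"
    and der: "AE t in lebesgue. t \<in> {a<..<b} \<longrightarrow> (F has_real_derivative g t) (at t)"
  shows "(g has_integral F b - F a) {a..b}"
proof -
  \<comment> \<open>The extension of \<open>F\<close> by constants keeps the Lipschitz bound and
    makes forward quotients available up to \<open>b\<close>.\<close>
  define H where "H t = F (max a (min b t))" for t
  define h where "h n = 1 / real (Suc n)" for n
  define \<phi> where "\<phi> n t = (H (t + h n) - H t) / h n" for n t
  have h0: "h n > 0" for n by (simp add: h_def)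
  have h_lim: "h \<longlonglongrightarrow> 0"
    unfolding h_def using LIMSEQ_inverse_real_of_nat by (simp add: inverse_eq_divide)
  have H_lip: "\<bar>H x - H y\<bar> \<le> K * \<bar>x - y\<bar>" for x y
  proof -
    have "\<bar>H x - H y\<bar> \<le> K * \<bar>max a (min b x) - max a (min b y)\<bar>"
      using lipschitz_onD[OF lip, of "max a (min b x)" "max a (min b y)"] ab
      by (simp add: H_def dist_real_def)
    also have "\<dots> \<le> K * \<bar>x - y\<bar>"
      by (intro mult_left_mono lipschitz_on_nonneg[OF lip]) linarith
    finally show ?thesis .
  qed
  have "K-lipschitz_on UNIV H"
    using H_lip lipschitz_on_nonneg[OF lip] by (intro lipschitz_onI) (auto simp: dist_real_def)
  then have H_cont: "continuous_on UNIV H" by (rule lipschitz_on_continuous_on)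
  then have H_cont': "continuous_on A H" for A using continuous_on_subset by blast
  obtain N where N: "N \<in> null_sets lebesgue"
    "{t. \<not> (t \<in> {a<..<b} \<longrightarrow> (F has_real_derivative g t) (at t))} \<subseteq> N"
    using der unfolding eventually_ae_filter by auto
  define N' where "N' = N \<union> {a, b}"
  \<comment> \<open>The dominated convergence theorem for the gauge integral asks for convergence at
    every point of the domain, so the null set is removed and restored at the end by
    spiking.\<close>
  define S where "S = {a..b} - N'"
  have N': "negligible N'" unfolding N'_def
    using N(1) by (auto simp: negligible_iff_null_sets)
  have neg: "negligible ({a..b} - S)" "negligible (S - {a..b})"
    by (rule negligible_subset[OF N'], auto simp: S_def)+
  have \<phi>_cont: "continuous_on {a..b} (\<phi> n)" for n
    unfolding \<phi>_def using h0[of n]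
    by (intro continuous_intros continuous_on_compose2[OF H_cont]) auto
  then have \<phi>_int: "\<phi> n integrable_on {a..b}" for n by (intro integrable_continuous_real)
  have \<phi>_S: "\<phi> n integrable_on S" for n
    by (rule integrable_spike_set[OF \<phi>_int]) (use neg in \<open>auto elim: negligible_subset\<close>)
  have \<phi>_eq: "integral S (\<phi> n) = integral {a..b} (\<phi> n)" for n
    by (rule integral_spike_set) (use neg in \<open>auto elim: negligible_subset\<close>)
  have bound: "norm (\<phi> n t) \<le> K" for n t
    using H_lip[of "t + h n" t] h0[of n] by (simp add: \<phi>_def divide_le_eq)
  have K_int: "(\<lambda>t. K) integrable_on S"
    by (rule integrable_spike_set[of _ "{a..b}"]) (use neg in \<open>auto elim: negligible_subset\<close>)
  have conv: "(\<lambda>n. \<phi> n t) \<longlonglongrightarrow> g t" if "t \<in> S" for t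
  proof -
    have t: "t \<in> {a<..<b}" "t \<notin> N" using that by (auto simp: S_def N'_def)
    then have "(F has_real_derivative g t) (at t)" using N(2) by blast
    then have "(H has_real_derivative g t) (at t)"
      by (rule has_field_derivative_transform_within_open[of _ _ _ "{a<..<b}"])
        (use t(1) in \<open>auto simp: H_def intro!: arg_cong[of _ _ F]\<close>)
    then have "((\<lambda>k. (H (t + k) - H t) / k) \<longlongrightarrow> g t) (at 0)" by (simp add: DERIV_def)
    moreover have "filterlim h (at 0) sequentially"
      using h_lim h0 by (auto simp: filterlim_at less_imp_neq[symmetric] intro!: always_eventually)
    ultimately show ?thesis unfolding \<phi>_def by (rule filterlim_compose)
  qed
  have dc: "g integrable_on S" "(\<lambda>n. integral S (\<phi> n)) \<longlonglongrightarrow> integral S g"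
    using dominated_convergence[OF \<phi>_S K_int bound conv] by auto
  \<comment> \<open>Starting at \<open>a - 1\<close> makes \<open>P\<close> differentiable from both
    sides also at \<open>a\<close>.\<close>
  define P where "P x = integral {a - 1..x} H" for x
  have P_der: "(P has_real_derivative H x) (at x)" if "x \<in> {a..b}" for x
  proof -
    have "((\<lambda>x. integral {a - 1..x} H) has_real_derivative H x) (at x within {a - 1..b + 1})"
      by (rule integral_has_real_derivative[OF H_cont']) (use that in auto)
    then show ?thesis unfolding P_def using that by (simp add: at_within_Icc_at)
  qed
  have P_seq: "(\<lambda>n. (P (x + h n) - P x) / h n) \<longlonglongrightarrow> H x" if "x \<in> {a..b}" for x
  proof -
    have "((\<lambda>k. (P (x + k) - P x) / k) \<longlongrightarrow> H x) (at 0)"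
      using P_der[OF that] by (simp add: DERIV_def)
    moreover have "filterlim h (at 0) sequentially"
      using h_lim h0 by (auto simp: filterlim_at less_imp_neq[symmetric] intro!: always_eventually)
    ultimately show ?thesis by (rule filterlim_compose)
  qed
  have P_diff: "integral {x..y} H = P y - P x" if "a - 1 \<le> x" "x \<le> y" for x y
    using Henstock_Kurzweil_Integration.integral_combine[OF that
        integrable_continuous_real[OF H_cont']] by (simp add: P_def)
  have \<phi>_val: "integral {a..b} (\<phi> n) = (P (b + h n) - P b) / h n - (P (a + h n) - P a) / h n" for n
  proof -
    have "integral {a..b} (\<lambda>t. H (t + h n)) = integral {a + h n..b + h n} H"
      using integral_shift[where a = a and b = b and c = "h n" and f = H] H_cont' by (simp add: o_def)
    then have "integral {a..b} (\<phi> n) = (integral {a + h n..b + h n} H - integral {a..b} H) / h n"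
      unfolding \<phi>_def
      by (subst integral_divide, subst Henstock_Kurzweil_Integration.integral_diff)
        (auto intro!: integrable_continuous_real continuous_intros continuous_on_compose2[OF H_cont])
    also have "\<dots> = ((P (b + h n) - P (a + h n)) - (P b - P a)) / h n"
      using ab h0[of n] by (subst (1 2) P_diff) auto
    finally show ?thesis by (simp add: diff_divide_distrib)
  qed
  have "(\<lambda>n. integral S (\<phi> n)) \<longlonglongrightarrow> H b - H a"
    unfolding \<phi>_eq \<phi>_val by (intro tendsto_diff P_seq) (use ab in auto)
  then have "integral S g = F b - F a"
    using LIMSEQ_unique[OF dc(2)] ab by (simp add: H_def)
  then have "(g has_integral (F b - F a)) S" using dc(1) by (simp add: has_integral_iff)
  then show ?thesis
    by (subst has_integral_spike_set_eq[of "{a..b}" S]) 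
      (use neg in \<open>auto elim: negligible_subset\<close>)
qed

text \<open>Choose a rational between \<open>x\<close> and \<open>x + e x\<close>, with
  \<open>e x\<close> an isolating radius. If two points share their rational, the larger one lies
  within the radius of the smaller one, so they agree.\<close>

lemma countable_isolated_points:
  fixes S :: "real set"
  assumes "\<And>x. x \<in> S \<Longrightarrow> \<exists>e>0. \<forall>y\<in>S. \<bar>y - x\<bar> < e \<longrightarrow> y = x"
  shows "countable S"
proof -
  obtain e where e: "\<And>x. x \<in> S \<Longrightarrow> e x > 0" "\<And>x y. x \<in> S \<Longrightarrow> y \<in> S \<Longrightarrow> \<bar>y - x\<bar> < e x \<Longrightarrow> y = x"
    using assms by metis
  have "\<exists>q::rat. x < of_rat q \<and> of_rat q < x + e x" if "x \<in> S" for x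
    using e(1)[OF that] of_rat_dense[of x "x + e x"] by auto
  then obtain q :: "real \<Rightarrow> rat" where q: "\<And>x. x \<in> S \<Longrightarrow> x < of_rat (q x) \<and> of_rat (q x) < x + e x"
    by metis
  have "inj_on q S"
  proof (rule inj_onI)
    fix x y assume xy: "x \<in> S" "y \<in> S" "q x = q y"
    then show "x = y"
      using q[OF xy(1)] q[OF xy(2)] e(2)[OF xy(1) xy(2)] e(2)[OF xy(2) xy(1)]
      by (cases "x \<le> y") auto
  qed
  then show ?thesis by (rule countableI')
qed

text \<open>Where \<open>r\<close> has nonzero derivative it meets each exceptional value of \<open>H\<close> only at isolated points;
  where its derivative vanishes the Lipschitz bound forces the derivative of the composition to vanish
  too, whatever \<open>h\<close> is.\<close>

lemma AE_chain_rule_lipschitz: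
  fixes H h r r' :: "real \<Rightarrow> real"
  assumes lip: "M-lipschitz_on {\<rho><..} H" and X: "countable X"
    and H: "\<And>x. \<rho> < x \<Longrightarrow> x \<notin> X \<Longrightarrow> (H has_real_derivative h x) (at x)"
    and r: "AE t in lebesgue. t \<in> A \<longrightarrow> (r has_real_derivative r' t) (at t)"
    and r_gt: "\<And>t. t \<in> A \<Longrightarrow> \<rho> < r t"
  shows "AE t in lebesgue. t \<in> A \<longrightarrow> ((\<lambda>t. H (r t)) has_real_derivative h (r t) * r' t) (at t)"
proof -
  define E where "E c = {t. r t = c \<and> r' t \<noteq> 0 \<and> (r has_real_derivative r' t) (at t)}" for c
  have "countable (E c)" for c
  proof (rule countable_isolated_points)
    fix t assume t: "t \<in> E c"
    then have "((\<lambda>y. (r y - r t) / (y - t)) \<longlongrightarrow> r' t) (at t)" "r' t \<noteq> 0"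
      by (auto simp: E_def has_field_derivative_iff)
    then have "\<forall>\<^sub>F y in at t. (r y - r t) / (y - t) \<noteq> 0"
      by (rule tendsto_imp_eventually_ne)
    then obtain d where "d > 0" "\<And>y. y \<noteq> t \<Longrightarrow> dist y t < d \<Longrightarrow> r y - r t \<noteq> 0"
      unfolding eventually_at by fastforce
    then show "\<exists>e>0. \<forall>y\<in>E c. \<bar>y - t\<bar> < e \<longrightarrow> y = t"
      using t by (intro exI[of _ d]) (auto simp: dist_real_def E_def)
  qed
  then have "countable (\<Union>c\<in>X. E c)" using X by blast
  then have null: "(\<Union>c\<in>X. E c) \<in> null_sets lebesgue"
    by (intro null_sets_completionI countable_imp_null_set_lborel)
  have "AE t in lebesgue. t \<notin> (\<Union>c\<in>X. E c)" using null by (rule AE_not_in)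
  with r show ?thesis
  proof eventually_elim
    case (elim t)
    show ?case
    proof
      assume t: "t \<in> A"
      then have rt: "(r has_real_derivative r' t) (at t)" using elim by blast
      show "((\<lambda>t. H (r t)) has_real_derivative h (r t) * r' t) (at t)"
      proof (cases "r' t = 0")
        case False
        then have "r t \<notin> X" using elim rt by (auto simp: E_def)
        then show ?thesis using DERIV_chain2[OF H rt] r_gt[OF t] by simp
      next
        case True
        have M: "M \<ge> 0" using lip by (rule lipschitz_on_nonneg)
        have "isCont r t" using rt by (rule DERIV_isCont)
        then have ev: "\<forall>\<^sub>F y in at t. \<rho> < r y"
          using r_gt[OF t] by (simp add: isCont_def order_tendstoD)
        have "((\<lambda>y. (r y - r t) / (y - t)) \<longlongrightarrow> 0) (at t)"
          using rt True by (simp add: has_field_derivative_iff)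
        then have z: "((\<lambda>y. M * \<bar>(r y - r t) / (y - t)\<bar>) \<longlongrightarrow> 0) (at t)"
          by (intro tendsto_mult_right_zero tendsto_rabs_zero)
        have "((\<lambda>y. (H (r y) - H (r t)) / (y - t)) \<longlongrightarrow> 0) (at t)"
        proof (rule Lim_null_comparison[OF _ z])
          show "\<forall>\<^sub>F y in at t. norm ((H (r y) - H (r t)) / (y - t)) \<le> M * \<bar>(r y - r t) / (y - t)\<bar>"
            using ev
          proof eventually_elim
            case (elim y)
            have "\<bar>H (r y) - H (r t)\<bar> \<le> M * \<bar>r y - r t\<bar>"
              using lipschitz_onD[OF lip, of "r y" "r t"] elim r_gt[OF t] by (simp add: dist_real_def)
            then show ?case by (simp add: abs_divide divide_right_mono)
          qed
        qed
        then show ?thesis using True by (simp add: has_field_derivative_iff)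
      qed
    qed
  qed
qed

section \<open>Integrals over a period, and passage from Lebesgue to Borel measure\<close>

lemma set_integrable_lborel_bounded:
  fixes h :: "real \<Rightarrow> real"
  assumes [measurable]: "h \<in> borel_measurable borel" "S \<in> sets borel" and S: "bounded S"
    and b: "\<And>x. x \<in> S \<Longrightarrow> \<bar>h x\<bar> \<le> B"
  shows "set_integrable lborel S h"
  unfolding set_integrable_def
proof (rule Bochner_Integration.integrable_bound)
  have "emeasure lborel S < \<infinity>"
    using S by (intro emeasure_bounded_finite)
  then show "integrable lborel (\<lambda>x. indicator S x *\<^sub>R B)" by (simp add: integrable_indicator_iff)
  show "AE x in lborel. norm (indicator S x *\<^sub>R h x) \<le> norm (indicator S x *\<^sub>R B)"
    using b by (intro always_eventually) (force simp: indicator_def)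
qed measurable

text \<open>The piece beyond \<open>L\<close> is translated back by one period. This lets each slice
  of the square be centred at its own base point.\<close>

lemma periodic_set_integral_shift:
  fixes h :: "real \<Rightarrow> real"
  assumes [measurable]: "h \<in> borel_measurable borel" and b: "\<And>x. \<bar>h x\<bar> \<le> B"
    and per: "\<And>x. h (x + L) = h x" and a: "0 \<le> a" "a \<le> L"
  shows "(LINT x:{a..<a + L}|lborel. h x) = (LINT x:{0..<L}|lborel. h x)"
proof -
  have si: "set_integrable lborel {u..<v} h" for u v
    by (rule set_integrable_lborel_bounded) (use b in auto)
  have "(LINT x:{L..<a + L}|lborel. h x) = (LINT x:{0..<a}|lborel. h x)"
    unfolding set_lebesgue_integral_def
    by (subst lborel_integral_real_affine[of 1 _ L])
      (auto simp: per add.commute[of L] indicator_def intro!: Bochner_Integration.integral_cong)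
  moreover have "(LINT x:{a..<a + L}|lborel. h x) = (LINT x:{a..<L}|lborel. h x) + (LINT x:{L..<a + L}|lborel. h x)"
    by (subst set_integral_Un[symmetric]) (use a si in \<open>auto intro!: arg_cong2[of _ _ _ _ "set_lebesgue_integral lborel"]\<close>)
  moreover have "(LINT x:{0..<L}|lborel. h x) = (LINT x:{0..<a}|lborel. h x) + (LINT x:{a..<L}|lborel. h x)"
    by (subst set_integral_Un[symmetric]) (use a si in \<open>auto intro!: arg_cong2[of _ _ _ _ "set_lebesgue_integral lborel"]\<close>)
  ultimately show ?thesis by simp
qed

lemma set_integral_Ico_eq_Icc:
  "(LINT x:{a..<b::real}|lborel. h x) = (LINT x:{a..b}|lborel. h x :: real)"
  "(LINT x:{a<..b::real}|lborel. h x) = (LINT x:{a..b}|lborel. h x :: real)"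
  by (rule set_integral_discrete_difference[where X="{a, b}"]; auto)+

text \<open>The substitution of \<open>L - x\<close> for \<open>x\<close> turns the half-open period
  around, and the end points do not matter to the integral.\<close>

lemma periodic_set_integral_reflect:
  fixes h :: "real \<Rightarrow> real"
  assumes per: "\<And>x. h (x + L) = h x"
  shows "(LINT x:{0..<L}|lborel. h (- x)) = (LINT x:{0..<L}|lborel. h x)"
proof -
  have "h (x - L) = h x" for x using per[of "x - L"] by simp
  then have "(LINT x:{0..<L}|lborel. h (- x)) = (LINT x:{0<..L}|lborel. h x)"
    unfolding set_lebesgue_integral_def
    by (subst lborel_integral_real_affine[of "-1" _ L])
      (auto simp: indicator_def intro!: Bochner_Integration.integral_cong)
  then show ?thesis by (simp add: set_integral_Ico_eq_Icc)
qed

text \<open>The energy and the principal value use completed measures on restricted spaces, while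
  Fubini and measurability arguments run on Borel sets. Completeness makes \<open>g\<close>
  measurable as soon as it agrees almost everywhere on \<open>S\<close> with the Borel function
  \<open>h\<close>.\<close>

lemma
  fixes g h :: "'a::euclidean_space \<Rightarrow> real"
  assumes h: "h \<in> borel_measurable borel" and S: "S \<in> sets borel"
    and gh: "AE x in lborel. x \<in> S \<longrightarrow> g x = h x"
  shows integrable_lebesgue_on_AE_borel: "integrable (lebesgue_on S) g \<longleftrightarrow> set_integrable lborel S h"
    and integral_lebesgue_on_AE_borel: "integral\<^sup>L (lebesgue_on S) g = (LINT x:S|lborel. h x)"
    and nn_integral_lebesgue_on_AE_borel:
      "(\<integral>\<^sup>+ x. ennreal (g x) \<partial>lebesgue_on S) = (\<integral>\<^sup>+ x. ennreal (h x) * indicator S x \<partial>lborel)"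
proof -
  have S': "S \<in> sets lebesgue" using S by simp
  have m: "(\<lambda>x. indicator S x *\<^sub>R h x) \<in> borel_measurable lborel" using h S by measurable
  then have m': "(\<lambda>x. indicator S x *\<^sub>R h x) \<in> borel_measurable lebesgue"
    by (rule measurable_completion)
  have eq: "AE x in lebesgue. indicator S x *\<^sub>R h x = indicator S x *\<^sub>R g x"
    using AE_completion[OF gh] by (auto simp: indicator_def elim!: eventually_mono)
  have mg: "(\<lambda>x. indicator S x *\<^sub>R g x) \<in> borel_measurable lebesgue"
    by (rule borel_measurable_AE[OF m' eq])
  have "integrable (lebesgue_on S) g \<longleftrightarrow> integrable lebesgue (\<lambda>x. indicator S x *\<^sub>R g x)"
    using S' by (intro integrable_restrict_space) auto
  also have "\<dots> \<longleftrightarrow> integrable lebesgue (\<lambda>x. indicator S x *\<^sub>R h x)"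
    by (rule integrable_cong_AE[OF m' mg eq, symmetric])
  finally show "integrable (lebesgue_on S) g \<longleftrightarrow> set_integrable lborel S h"
    by (simp only: integrable_completion[OF m] set_integrable_def)
  have "integral\<^sup>L (lebesgue_on S) g = integral\<^sup>L lebesgue (\<lambda>x. indicator S x *\<^sub>R g x)"
    using S' by (intro integral_restrict_space) auto
  also have "\<dots> = integral\<^sup>L lebesgue (\<lambda>x. indicator S x *\<^sub>R h x)"
    by (rule integral_cong_AE[OF m' mg eq, symmetric])
  finally show "integral\<^sup>L (lebesgue_on S) g = (LINT x:S|lborel. h x)"
    by (simp only: integral_completion[OF m] set_lebesgue_integral_def)
  have "(\<integral>\<^sup>+ x. ennreal (g x) \<partial>lebesgue_on S) = (\<integral>\<^sup>+ x. ennreal (g x) * indicator S x \<partial>lebesgue)"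
    using S' by (subst nn_integral_restrict_space) auto
  also have "\<dots> = (\<integral>\<^sup>+ x. ennreal (h x) * indicator S x \<partial>lebesgue)"
    using AE_completion[OF gh] by (intro nn_integral_cong_AE) (auto simp: indicator_def elim!: eventually_mono)
  finally show "(\<integral>\<^sup>+ x. ennreal (g x) \<partial>lebesgue_on S) = (\<integral>\<^sup>+ x. ennreal (h x) * indicator S x \<partial>lborel)"
    by (simp add: nn_integral_completion)
qed

section \<open>Null sets in the plane, difference quotients and reflection\<close>

lemma AE_lborel_fst_snd:
  fixes P :: "real \<Rightarrow> bool"
  assumes "AE x in lborel. P x"
  shows "AE p in lborel. P (fst p) \<and> P (snd p)"
proof -
  obtain N where N: "N \<in> null_sets lborel" "{x. \<not> P x} \<subseteq> N"
    using assms unfolding eventually_ae_filter by auto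
  then have [measurable]: "N \<in> sets borel" by auto
  have N_AE: "AE x in lborel. x \<notin> N" using N(1) by (rule AE_not_in)
  have "AE p in (lborel :: real measure) \<Otimes>\<^sub>M (lborel :: real measure). fst p \<notin> N \<and> snd p \<notin> N"
  proof (rule lborel_pair.AE_pair_measure)
    show "AE x in lborel. AE y in lborel. fst (x, y) \<notin> N \<and> snd (x, y) \<notin> N"
      using N_AE by (auto elim!: eventually_mono)
  qed measurable
  then show ?thesis
    unfolding lborel_prod by (rule eventually_mono) (use N(2) in auto)
qed

lemma AE_lborel_fst_neq_snd: "AE p in (lborel :: (real \<times> real) measure). fst p \<noteq> snd p"
proof -
  have "AE p in (lborel :: real measure) \<Otimes>\<^sub>M (lborel :: real measure). fst p \<noteq> snd p"
  proof (rule lborel_pair.AE_pair_measure)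
    show "AE x in lborel. AE y in lborel. fst (x, y) \<noteq> (snd (x, y) :: real)"
    proof (rule AE_I2)
      show "AE y in lborel. fst (x, y) \<noteq> snd (x, y)" for x :: real
        using AE_lborel_singleton[of x] by (rule eventually_mono) auto
    qed
  qed measurable
  then show ?thesis unfolding lborel_prod .
qed

lemma has_vector_derivative_quotient:
  assumes "(f has_vector_derivative v) (at s)"
  shows "((\<lambda>h. (1 / h) *\<^sub>R (f (s + h) - f s)) \<longlongrightarrow> v) (at 0)"
proof -
  have "((\<lambda>h. norm (f (s + h) - f s - h *\<^sub>R v) / norm h) \<longlongrightarrow> 0) (at 0)"
    using assms by (simp add: has_vector_derivative_def has_derivative_at)
  also have "?this \<longleftrightarrow> ((\<lambda>h. norm ((1 / h) *\<^sub>R (f (s + h) - f s) - v)) \<longlongrightarrow> 0) (at 0)"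
  proof (rule tendsto_cong, unfold eventually_at_filter, intro always_eventually allI impI)
    fix h :: real assume "h \<noteq> 0"
    then have "(1 / h) *\<^sub>R (f (s + h) - f s) - v = (1 / h) *\<^sub>R (f (s + h) - f s - h *\<^sub>R v)"
      by (simp add: scaleR_right_diff_distrib)
    then show "norm (f (s + h) - f s - h *\<^sub>R v) / norm h = norm ((1 / h) *\<^sub>R (f (s + h) - f s) - v)"
      by simp
  qed
  finally show ?thesis by (rule LIM_zero_cancel[OF tendsto_norm_zero_cancel])
qed

lemma AE_lborel_uminus:
  fixes P :: "real \<Rightarrow> bool"
  assumes "AE x in lborel. P x"
  shows "AE x in lborel. P (- x)"
proof -
  obtain N where N: "N \<in> null_sets lborel" "{x. \<not> P x} \<subseteq> N"
    using assms unfolding eventually_ae_filter by auto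
  then have [measurable]: "N \<in> sets borel" by auto
  have "AE x in lborel. 0 + -1 * x \<notin> N"
    by (rule AE_borel_affine[where P="\<lambda>x. x \<notin> N"]) (use N(1) AE_not_in in auto)
  then show ?thesis by (rule eventually_mono) (use N(2) in auto)
qed

section \<open>Distance on the circle\<close>

lemma circle_dist_le: "circle_dist L s t \<le> \<bar>s - t - of_int k * L\<bar>"
  unfolding circle_dist_def by (rule cINF_lower) (auto intro!: bdd_belowI[of _ 0])

lemma circle_dist_nonneg: "0 \<le> circle_dist L s t"
  unfolding circle_dist_def by (rule cINF_greatest) auto

text \<open>Only \<open>k = 0\<close> and one of \<open>k = 1\<close>, \<open>k = -1\<close> can be
  optimal: every nonzero multiple of \<open>L\<close> is at least \<open>L\<close> in size, so it
  leaves a distance of at least \<open>L - \<bar>s - t\<bar>\<close>.\<close>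

lemma circle_dist_eq:
  assumes "\<bar>s - t\<bar> \<le> L"
  shows "circle_dist L s t = min \<bar>s - t\<bar> (L - \<bar>s - t\<bar>)"
proof (rule antisym)
  have "circle_dist L s t \<le> L - \<bar>s - t\<bar>"
    using circle_dist_le[of L s t 1, simplified] circle_dist_le[of L s t "-1", simplified] assms
    by linarith
  then show "circle_dist L s t \<le> min \<bar>s - t\<bar> (L - \<bar>s - t\<bar>)"
    using circle_dist_le[of L s t 0] by simp
  show "min \<bar>s - t\<bar> (L - \<bar>s - t\<bar>) \<le> circle_dist L s t"
    unfolding circle_dist_def
  proof (rule cINF_greatest)
    fix k :: int
    consider "k = 0" | "k \<ge> 1" | "k \<le> -1" by linarith
    then show "min \<bar>s - t\<bar> (L - \<bar>s - t\<bar>) \<le> \<bar>s - t - of_int k * L\<bar>"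
    proof cases
      case 2
      then have "1 * L \<le> of_int k * L" using assms by (intro mult_right_mono) auto
      then show ?thesis by linarith
    next
      case 3
      then have "of_int k * L \<le> -1 * L" using assms by (intro mult_right_mono) auto
      then show ?thesis by linarith
    qed simp
  qed simp
qed

lemma circle_dist_shift: "circle_dist L s (t + L) = circle_dist L s t"
proof -
  have *: "s - (t + L) - of_int k * L = s - t - of_int (k + 1) * L" for k
    by (simp add: algebra_simps)
  have "range (\<lambda>k. \<bar>s - t - of_int (k + 1) * L\<bar>) = (\<lambda>k. \<bar>s - t - of_int k * L\<bar>) ` range (\<lambda>k::int. k + 1)"
    by (simp only: image_image)
  also have "range (\<lambda>k::int. k + 1) = UNIV" by (rule surj_plus_right)
  finally show ?thesis unfolding circle_dist_def * by simp
qed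

lemma circle_dist_measurable [measurable]:
  assumes [measurable]: "u \<in> borel_measurable M" "v \<in> borel_measurable M"
  shows "(\<lambda>x. circle_dist L (u x) (v x)) \<in> borel_measurable M"
  unfolding circle_dist_def
  by (rule borel_measurable_cINF) (auto intro!: bdd_belowI[of _ 0])

lemma circle_dist_minus: "circle_dist L (- s) (- t) = circle_dist L s t"
proof -
  have *: "\<bar>- s - - t - of_int k * L\<bar> = \<bar>s - t - of_int (- k) * L\<bar>" for k
    by simp
  have "range (\<lambda>k. \<bar>s - t - of_int (- k) * L\<bar>) = (\<lambda>k. \<bar>s - t - of_int k * L\<bar>) ` range (uminus :: int \<Rightarrow> int)"
    by (simp only: image_image)
  then show ?thesis unfolding circle_dist_def * by simp
qed

section \<open>The square without a strip around the diagonal\<close>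

definition off_diagonal_square :: "real \<Rightarrow> real \<Rightarrow> (real \<times> real) set" where
  "off_diagonal_square L \<epsilon> = ({0..<L} \<times> {0..<L}) \<inter> off_diagonal L \<epsilon>"

lemma off_diagonal_measurable [measurable]:
  "off_diagonal L \<epsilon> \<in> sets borel" "off_diagonal_square L \<epsilon> \<in> sets borel"
proof -
  have "{p \<in> space (borel :: (real \<times> real) measure). \<epsilon> \<le> circle_dist L (fst p) (snd p)} \<in> sets borel"
    unfolding borel_prod[symmetric] by measurable
  then show "off_diagonal L \<epsilon> \<in> sets borel"
    by (simp add: off_diagonal_def split_def)
  then show "off_diagonal_square L \<epsilon> \<in> sets borel"
    unfolding off_diagonal_square_def by (intro sets.Int) (auto intro: borel_Times)
qed

text \<open>Fubini with the first variable outside. The inner slice is moved from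
  \<open>{0..<L}\<close> to \<open>{s..<s + L}\<close>, where distance at least
  \<open>\<epsilon>\<close> from \<open>s\<close> means exactly membership in the interval
  \<open>{s + \<epsilon>..s + L - \<epsilon>}\<close>.\<close>

lemma
  fixes h :: "real \<times> real \<Rightarrow> real"
  assumes \<epsilon>: "0 < \<epsilon>" "\<epsilon> < L / 2" and h [measurable]: "h \<in> borel_measurable borel"
    and bound: "\<And>s t. \<epsilon> \<le> circle_dist L s t \<Longrightarrow> \<bar>h (s, t)\<bar> \<le> B"
  shows set_integrable_off_diagonal: "set_integrable lborel (off_diagonal_square L \<epsilon>) h"
    and set_integral_off_diagonal:
      "(\<And>s t. h (s, t + L) = h (s, t)) \<Longrightarrow>
        (LINT p:off_diagonal_square L \<epsilon>|lborel. h p)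
        = (LINT s:{0..<L}|lborel. (LINT t:{s + \<epsilon>..s + L - \<epsilon>}|lborel. h (s, t)))"
proof -
  let ?S = "off_diagonal_square L \<epsilon>"
  \<comment> \<open>The parameters \<open>0\<close> and \<open>\<epsilon>\<close> are at distance
    exactly \<open>\<epsilon>\<close>, because \<open>\<epsilon> < L / 2\<close>; the bound
    therefore applies to at least one pair.\<close>
  have B: "0 \<le> B"
    using bound[of 0 \<epsilon>] \<epsilon> by (simp add: circle_dist_eq)
  show si: "set_integrable lborel ?S h"
    unfolding set_integrable_def
  proof (rule Bochner_Integration.integrable_bound)
    have "bounded ({0..<L} \<times> {0..<L} :: (real \<times> real) set)" by (intro bounded_Times) auto
    then have "bounded ?S" by (rule bounded_subset) (auto simp: off_diagonal_square_def)
    then have "emeasure lborel ?S < \<infinity>" by (rule emeasure_bounded_finite)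
    then show "integrable lborel (\<lambda>x. indicator ?S x *\<^sub>R B)" by (simp add: integrable_indicator_iff)
    show "AE x in lborel. norm (indicator ?S x *\<^sub>R h x) \<le> norm (indicator ?S x *\<^sub>R B)"
      using bound B
      by (intro always_eventually) (auto simp: indicator_def off_diagonal_square_def off_diagonal_def)
  qed measurable
  assume per: "\<And>s t. h (s, t + L) = h (s, t)"
  have int: "integrable (lborel \<Otimes>\<^sub>M lborel) (\<lambda>p. indicator ?S p *\<^sub>R h p)"
    using si unfolding set_integrable_def lborel_prod .
  have inner: "(LINT t|lborel. indicator ?S (s, t) *\<^sub>R h (s, t))
      = indicator {0..<L} s *\<^sub>R (LINT t:{s + \<epsilon>..s + L - \<epsilon>}|lborel. h (s, t))" for s
  proof (cases "s \<in> {0..<L}")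
    case True
    define k where "k t = indicator (off_diagonal L \<epsilon>) (s, t) * h (s, t)" for t
    have [measurable]: "k \<in> borel_measurable borel"
    proof -
      have "(\<lambda>p. indicator (off_diagonal L \<epsilon>) p * h p) \<in> borel_measurable (borel \<Otimes>\<^sub>M borel)"
        unfolding borel_prod by measurable
      then show ?thesis unfolding k_def by measurable
    qed
    have "(LINT t|lborel. indicator ?S (s, t) *\<^sub>R h (s, t)) = (LINT t:{0..<L}|lborel. k t)"
      unfolding set_lebesgue_integral_def k_def
      by (rule Bochner_Integration.integral_cong)
        (use True in \<open>auto simp: off_diagonal_square_def indicator_def\<close>)
    also have "\<dots> = (LINT t:{s..<s + L}|lborel. k t)"
    proof (rule periodic_set_integral_shift[symmetric])
      show "\<bar>k x\<bar> \<le> B" for x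
        using bound[of s x] B by (auto simp: k_def off_diagonal_def indicator_def)
      show "k (x + L) = k x" for x
        by (simp add: k_def off_diagonal_def indicator_def per circle_dist_shift)
    qed (use True in auto)
    also have "\<dots> = (LINT t:{s + \<epsilon>..s + L - \<epsilon>}|lborel. h (s, t))"
      unfolding set_lebesgue_integral_def k_def
      by (rule Bochner_Integration.integral_cong)
        (use \<epsilon> in \<open>auto simp: off_diagonal_def indicator_def circle_dist_eq\<close>)
    finally show ?thesis using True by simp
  next
    case False
    then have "(s, t) \<notin> ?S" for t by (auto simp: off_diagonal_square_def)
    then show ?thesis using False by simp
  qed
  show "(LINT p:?S|lborel. h p)
      = (LINT s:{0..<L}|lborel. (LINT t:{s + \<epsilon>..s + L - \<epsilon>}|lborel. h (s, t)))"
    using lborel_pair.integral_fst'[OF int]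
    unfolding inner lborel_prod set_lebesgue_integral_def by simp
qed

lemma off_diagonal_square_mono: "\<delta> \<le> \<epsilon> \<Longrightarrow> off_diagonal_square L \<epsilon> \<subseteq> off_diagonal_square L \<delta>"
  by (auto simp: off_diagonal_square_def off_diagonal_def)

lemma indicator_off_diagonal_square:
  "indicator ({0..<L} \<times> {0..<L}) p *\<^sub>R (indicator (off_diagonal L \<epsilon>) p *\<^sub>R (x :: real))
    = indicator (off_diagonal_square L \<epsilon>) p *\<^sub>R x"
  by (simp add: off_diagonal_square_def indicator_def)

lemma
  fixes g h :: "real \<times> real \<Rightarrow> real"
  assumes h [measurable]: "h \<in> borel_measurable borel"
    and gh: "AE p in lborel. p \<in> {0..<L} \<times> {0..<L} \<longrightarrow> g p = h p"
  shows set_integrable_torus_off_diagonal: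
      "set_integrable (torus_measure L) (off_diagonal L \<epsilon>) g \<longleftrightarrow>
        set_integrable lborel (off_diagonal_square L \<epsilon>) h"
    and set_integral_torus_off_diagonal:
      "(LINT p:off_diagonal L \<epsilon>|torus_measure L. g p) = (LINT p:off_diagonal_square L \<epsilon>|lborel. h p)"
proof -
  have m: "(\<lambda>p. indicator (off_diagonal L \<epsilon>) p *\<^sub>R h p) \<in> borel_measurable borel" by measurable
  have S: "{0..<L} \<times> {0..<L} \<in> sets (borel :: (real \<times> real) measure)" by (intro borel_Times) auto
  have ae: "AE p in lborel. p \<in> {0..<L} \<times> {0..<L} \<longrightarrow>
      indicator (off_diagonal L \<epsilon>) p *\<^sub>R g p = indicator (off_diagonal L \<epsilon>) p *\<^sub>R h p"
    using gh by (rule eventually_mono) auto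
  show "set_integrable (torus_measure L) (off_diagonal L \<epsilon>) g \<longleftrightarrow>
        set_integrable lborel (off_diagonal_square L \<epsilon>) h"
    using integrable_lebesgue_on_AE_borel[OF m S ae]
    by (simp only: set_integrable_def indicator_off_diagonal_square)
  show "(LINT p:off_diagonal L \<epsilon>|torus_measure L. g p) = (LINT p:off_diagonal_square L \<epsilon>|lborel. h p)"
    using integral_lebesgue_on_AE_borel[OF m S ae]
    by (simp only: set_lebesgue_integral_def indicator_off_diagonal_square)
qed

section \<open>The weight\<close>

locale energy_weight =
  fixes \<Phi> :: "real \<Rightarrow> real"
  assumes Phi_pos: "\<And>x. 0 < x \<Longrightarrow> 0 < \<Phi> x"
    and Phi_mono: "mono_on {0<..} \<Phi>"
    and Phi_integrable: "\<And>x. 0 < x \<Longrightarrow> set_integrable lebesgue {x..} (\<lambda>t. 1 / \<Phi> t)"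
begin

text \<open>The values of \<open>\<Phi>\<close> outside the positive reals are arbitrary, so that \<open>1 / \<Phi>\<close> need not be
  measurable on the whole line.\<close>

definition recip :: "real \<Rightarrow> real" where
  "recip x = (if 0 < x then 1 / \<Phi> x else 0)"

lemma recip_nonneg: "0 \<le> recip x"
  using Phi_pos[of x] by (auto simp: recip_def less_imp_le)

lemma recip_antimono: "0 < x \<Longrightarrow> x \<le> y \<Longrightarrow> recip y \<le> recip x"
  using Phi_pos[of x] mono_onD[OF Phi_mono, of x y]
  by (auto simp: recip_def intro!: divide_left_mono mult_pos_pos Phi_pos)

lemma recip_measurable [measurable]: "recip \<in> borel_measurable borel"
proof -
  have "mono_on {0<..} (\<lambda>x. - recip x)"
    by (rule mono_onI) (use recip_antimono in auto)
  then have "(\<lambda>x. - recip x) \<in> borel_measurable (restrict_space borel {0<..})"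
    by (rule borel_measurable_mono_on_fnc)
  then have "(\<lambda>x. indicator {0<..} x *\<^sub>R - recip x) \<in> borel_measurable borel"
    by (subst (asm) borel_measurable_restrict_space_iff) auto
  then have "(\<lambda>x. - (indicator {0<..} x *\<^sub>R - recip x)) \<in> borel_measurable borel"
    by measurable
  also have "(\<lambda>x. - (indicator {0<..} x *\<^sub>R - recip x)) = recip"
    by (auto simp: recip_def indicator_def)
  finally show ?thesis .
qed

lemma tail_nonneg: "0 \<le> tail_integral \<Phi> x" if "0 < x"
  unfolding tail_integral_def set_lebesgue_integral_def
  by (rule Bochner_Integration.integral_nonneg)
    (use that Phi_pos in \<open>auto simp: indicator_def less_imp_le\<close>)

lemma
  assumes "0 < x" "x \<le> y"
  shows recip_integrable_on: "recip integrable_on {x..y}"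
    and tail_split: "tail_integral \<Phi> x = integral {x..y} recip + tail_integral \<Phi> y"
proof -
  have h: "((\<lambda>t. 1 / \<Phi> t) has_integral tail_integral \<Phi> z) {z..}" if "0 < z" for z
    unfolding tail_integral_def by (rule has_integral_set_lebesgue[OF Phi_integrable[OF that]])
  have "(\<lambda>t. 1 / \<Phi> t) integrable_on {x..y}"
    by (rule set_lebesgue_integral_eq_integral(1), rule set_integrable_subset[OF Phi_integrable[of x]])
      (use assms in auto)
  then show i: "recip integrable_on {x..y}"
    by (rule integrable_eq) (use assms in \<open>auto simp: recip_def\<close>)
  have "(recip has_integral integral {x..y} recip + tail_integral \<Phi> y) ({x..y} \<union> {y..})"
  proof (rule has_integral_Un[OF integrable_integral[OF i]])
    show "(recip has_integral tail_integral \<Phi> y) {y..}"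
      by (rule has_integral_eq[OF _ h[of y]]) (use assms in \<open>auto simp: recip_def\<close>)
    have "{x..y} \<inter> {y..} = {y}" using assms by auto
    then show "negligible ({x..y} \<inter> {y..})" by simp
  qed
  moreover have "{x..y} \<union> {y..} = {x..}" using assms by auto
  moreover have "(recip has_integral tail_integral \<Phi> x) {x..}"
    by (rule has_integral_eq[OF _ h[of x]]) (use assms in \<open>auto simp: recip_def\<close>)
  ultimately show "tail_integral \<Phi> x = integral {x..y} recip + tail_integral \<Phi> y"
    by (metis has_integral_unique)
qed

lemma tail_antimono: "tail_integral \<Phi> y \<le> tail_integral \<Phi> x"
  and tail_diff_le: "tail_integral \<Phi> x - tail_integral \<Phi> y \<le> recip x * (y - x)"
  if "0 < x" "x \<le> y"
proof -
  note i = recip_integrable_on[OF that]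
  have "0 \<le> integral {x..y} recip"
    by (rule Henstock_Kurzweil_Integration.integral_nonneg[OF i recip_nonneg])
  then show "tail_integral \<Phi> y \<le> tail_integral \<Phi> x" using tail_split[OF that] by simp
  have "integral {x..y} recip \<le> integral {x..y} (\<lambda>t. recip x)"
    by (rule Henstock_Kurzweil_Integration.integral_le[OF i])
      (use that in \<open>auto intro: recip_antimono\<close>)
  then show "tail_integral \<Phi> x - tail_integral \<Phi> y \<le> recip x * (y - x)"
    using tail_split[OF that] that by (simp add: mult.commute)
qed

text \<open>A monotone function has only countably many discontinuities. They form the set of
  exceptional values in the chain rule for \<open>Lam \<Phi>\<close> composed with the chord
  length.\<close>

lemma countable_recip_discont: "countable {x. 0 < x \<and> \<not> isCont recip x}"
proof -
  have "mono_on {0<..} (\<lambda>x. - recip x)"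
    by (rule mono_onI) (use recip_antimono in auto)
  from mono_on_ctble_discont_open[OF _ this] have "countable {a \<in> {0<..}. \<not> isCont (\<lambda>x. - recip x) a}"
    by simp
  moreover have "isCont (\<lambda>x. - recip x) a \<longleftrightarrow> isCont recip a" for a
    using isCont_minus[of a recip] isCont_minus[of a "\<lambda>x. - recip x"] by auto
  ultimately show ?thesis by simp
qed

text \<open>Near \<open>x\<close> the tail is a constant minus the integral of \<open>recip\<close>
  from \<open>x / 2\<close>, a base point that keeps away from the possible singularity at
  zero.\<close>

lemma tail_has_derivative:
  assumes x: "0 < x" and c: "isCont recip x"
  shows "(tail_integral \<Phi> has_real_derivative - recip x) (at x)"
proof -
  have "((\<lambda>u. integral {x / 2..u} recip) has_vector_derivative recip x) (at x within ({x / 2..x + 1} - {}))"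
    by (rule integral_has_vector_derivative_continuous_at)
      (use x c in \<open>auto intro!: recip_integrable_on continuous_at_imp_continuous_at_within\<close>)
  then have "((\<lambda>u. integral {x / 2..u} recip) has_real_derivative recip x) (at x)"
    using x by (simp add: at_within_Icc_at has_real_derivative_iff_has_vector_derivative)
  then have "((\<lambda>u. tail_integral \<Phi> (x / 2) - integral {x / 2..u} recip) has_real_derivative 0 - recip x) (at x)"
    by (intro DERIV_diff DERIV_const)
  then have "(tail_integral \<Phi> has_real_derivative 0 - recip x) (at x)"
    by (rule has_field_derivative_transform_within_open[where S="{x / 2<..}"])
      (use x tail_split[of "x / 2"] in \<open>auto simp: algebra_simps\<close>)
  then show ?thesis by simp
qed

lemma Lam_nonpos: "0 \<le> x \<Longrightarrow> Lam \<Phi> x \<le> 0"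
  using tail_nonneg[of x] by (cases "x = 0") (auto simp: Lam_def)

lemma Lam_bound:
  assumes "0 < \<rho>" "\<rho> \<le> x"
  shows "\<bar>Lam \<Phi> x\<bar> \<le> tail_integral \<Phi> \<rho> / \<rho>"
proof -
  have "\<bar>Lam \<Phi> x\<bar> = tail_integral \<Phi> x / x"
    using tail_nonneg[of x] assms by (simp add: Lam_def)
  also have "\<dots> \<le> tail_integral \<Phi> \<rho> / \<rho>"
    using assms tail_antimono[OF assms] tail_nonneg[of \<rho>] by (intro frac_le) auto
  finally show ?thesis .
qed

text \<open>The difference of two values splits into the change of the tail, controlled by the
  largest value of \<open>recip\<close>, and the change of the factor \<open>1 / t\<close>,
  controlled by the largest tail. Both are finite away from zero.\<close>

lemma Lam_lipschitz:
  assumes \<rho>: "0 < \<rho>"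
  shows "(recip \<rho> / \<rho> + tail_integral \<Phi> \<rho> / \<rho>\<^sup>2)-lipschitz_on {\<rho>..} (Lam \<Phi>)"
proof (rule lipschitz_on_leI)
  fix x y :: real assume "x \<in> {\<rho>..}" "y \<in> {\<rho>..}" "x \<le> y"
  then have xy: "\<rho> \<le> x" "x \<le> y" "0 < x" "0 < y" using \<rho> by auto
  have "Lam \<Phi> x - Lam \<Phi> y
      = - ((tail_integral \<Phi> x - tail_integral \<Phi> y) / x + tail_integral \<Phi> y * (y - x) / (x * y))"
    using xy by (simp add: Lam_def field_simps)
  then have "dist (Lam \<Phi> x) (Lam \<Phi> y)
      = (tail_integral \<Phi> x - tail_integral \<Phi> y) / x + tail_integral \<Phi> y * (y - x) / (x * y)"
    using xy tail_antimono[of x y] tail_nonneg[of y] unfolding dist_real_def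
    by (subst abs_of_nonpos) (simp_all add: add_nonneg_nonneg del: minus_add_distrib)
  also have "\<dots> \<le> recip \<rho> * (y - x) / \<rho> + tail_integral \<Phi> \<rho> * (y - x) / (\<rho> * \<rho>)"
  proof (intro add_mono frac_le mult_mono)
    show "tail_integral \<Phi> x - tail_integral \<Phi> y \<le> recip \<rho> * (y - x)"
      using tail_diff_le[of x y] mult_right_mono[OF recip_antimono[of \<rho> x], of "y - x"] xy \<rho> by simp
  qed (use xy \<rho> tail_antimono[of \<rho> y] tail_nonneg recip_nonneg in auto)
  also have "\<dots> = (recip \<rho> / \<rho> + tail_integral \<Phi> \<rho> / \<rho>\<^sup>2) * dist x y"
    using xy by (simp add: dist_real_def algebra_simps power2_eq_square)
  finally show "dist (Lam \<Phi> x) (Lam \<Phi> y) \<le> \<dots>" .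
qed (use \<rho> tail_nonneg[OF \<rho>] recip_nonneg[of \<rho>] in simp)

lemma Lam_has_derivative:
  assumes x: "0 < x" and c: "isCont recip x"
  shows "(Lam \<Phi> has_real_derivative (recip x - Lam \<Phi> x) / x) (at x)"
proof -
  have "((\<lambda>x. - (1 / x) * tail_integral \<Phi> x) has_real_derivative
      (1 / x\<^sup>2) * tail_integral \<Phi> x + - recip x * - (1 / x)) (at x)"
    by (rule DERIV_mult, use x in \<open>auto intro!: derivative_eq_intros simp: power2_eq_square\<close>)
      (intro tail_has_derivative x c)
  also have "(\<lambda>x. - (1 / x) * tail_integral \<Phi> x) = Lam \<Phi>" by (simp add: Lam_def[abs_def])
  also have "(1 / x\<^sup>2) * tail_integral \<Phi> x + - recip x * - (1 / x) = (recip x - Lam \<Phi> x) / x"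
    using x by (simp add: Lam_def power2_eq_square field_simps)
  finally show ?thesis .
qed

lemma Lam_continuous_on: "continuous_on {0<..} (Lam \<Phi>)"
proof (rule continuous_at_imp_continuous_on, safe)
  fix x :: real assume x: "0 < x"
  have "continuous_on {x / 2..} (Lam \<Phi>)"
    using Lam_lipschitz[of "x / 2"] x by (intro lipschitz_on_continuous_on) auto
  then show "isCont (Lam \<Phi>) x"
    using x by (auto intro!: continuous_on_interior[of "{x / 2..}"])
qed

lemma Lam_norm_measurable [measurable]:
  assumes [measurable]: "u \<in> borel_measurable M"
  shows "(\<lambda>x. Lam \<Phi> (norm (u x))) \<in> borel_measurable M"
proof -
  have "(\<lambda>x. if 0 < x then Lam \<Phi> x else 0) \<in> borel_measurable borel"
    using borel_measurable_continuous_on_if[of "{0<..}" "Lam \<Phi>" "\<lambda>_. 0"] Lam_continuous_on by simp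
  then have "(\<lambda>x. (\<lambda>x. if 0 < x then Lam \<Phi> x else 0) (norm (u x))) \<in> borel_measurable M"
    by measurable
  \<comment> \<open>Division by zero yields zero, so \<open>Lam \<Phi> 0 = 0\<close> and the cut-off
    at zero changes nothing on norms.\<close>
  moreover have "(if 0 < norm v then Lam \<Phi> (norm v) else 0) = Lam \<Phi> (norm v)" for v :: 'b
    by (simp add: Lam_def)
  ultimately show ?thesis by simp
qed

text \<open>The interval is split at the point antipodal to \<open>s\<close>. On the two halves the
  distance is \<open>t - s\<close> and \<open>s + L - t\<close>, and each half contributes the
  integral of \<open>recip\<close> over \<open>{\<epsilon>..L / 2}\<close>.\<close>

lemma recip_circle_dist_integral:
  assumes \<epsilon>: "0 < \<epsilon>" "\<epsilon> < L / 2"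
  shows "(LINT t:{s + \<epsilon>..s + L - \<epsilon>}|lborel. recip (circle_dist L s t))
    = 2 * (tail_integral \<Phi> \<epsilon> - tail_integral \<Phi> (L / 2))"
proof -
  have bd: "\<bar>recip x\<bar> \<le> recip \<epsilon>" if "\<epsilon> \<le> x" for x
    using recip_antimono[of \<epsilon> x] recip_nonneg[of x] that \<epsilon> by simp
  have si: "set_integrable lborel {s + \<epsilon>..s + L - \<epsilon>} (\<lambda>t. recip (circle_dist L s t))"
    by (rule set_integrable_lborel_bounded[of _ _ "recip \<epsilon>"])
      (use \<epsilon> in \<open>auto intro!: bd simp: circle_dist_eq\<close>)
  have base: "(LINT x:{\<epsilon>..L / 2}|lborel. recip x) = tail_integral \<Phi> \<epsilon> - tail_integral \<Phi> (L / 2)"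
  proof -
    have "set_integrable lborel {\<epsilon>..L / 2} recip"
      by (rule set_integrable_lborel_bounded[OF _ _ _ bd]) auto
    then show ?thesis
      using set_borel_integral_eq_integral(2) tail_split[of \<epsilon> "L / 2"] \<epsilon> by force
  qed
  have "(LINT t:{s + \<epsilon>..s + L - \<epsilon>}|lborel. recip (circle_dist L s t))
      = (LINT t:{s + \<epsilon>..s + L / 2}|lborel. recip (circle_dist L s t))
        + (LINT t:{s + L / 2<..s + L - \<epsilon>}|lborel. recip (circle_dist L s t))"
    by (subst set_integral_Un[symmetric])
      (use \<epsilon> in \<open>auto intro!: set_integrable_subset[OF si] arg_cong2[of _ _ _ _ "set_lebesgue_integral lborel"]\<close>)
  also have "(LINT t:{s + \<epsilon>..s + L / 2}|lborel. recip (circle_dist L s t)) = (LINT x:{\<epsilon>..L / 2}|lborel. recip x)"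
    unfolding set_lebesgue_integral_def
    by (subst lborel_integral_real_affine[of 1 _ s])
      (use \<epsilon> in \<open>auto intro!: Bochner_Integration.integral_cong simp: indicator_def circle_dist_eq\<close>)
  also have "(LINT t:{s + L / 2<..s + L - \<epsilon>}|lborel. recip (circle_dist L s t)) = (LINT x:{\<epsilon>..<L / 2}|lborel. recip x)"
    unfolding set_lebesgue_integral_def
    by (subst lborel_integral_real_affine[of "-1" _ "s + L"])
      (use \<epsilon> in \<open>auto intro!: Bochner_Integration.integral_cong simp: indicator_def circle_dist_eq\<close>)
  finally show ?thesis by (simp add: set_integral_Ico_eq_Icc base)
qed

end

section \<open>Closed curves parametrized by arc-length\<close>

locale arclength_curve =
  fixes L :: real and f :: "real \<Rightarrow> 'a::euclidean_space"
  assumes L_pos: "0 < L" and curve: "arclength_closed_curve L f"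
begin

lemma f_periodic: "f (x + L) = f x"
  using periodic_fun_simple.plus_period[of f L] curve by (simp add: arclength_closed_curve_def)

lemma f_periodic_int: "f (x + of_int k * L) = f x"
proof -
  interpret periodic_fun_simple f L
    using curve by (simp add: arclength_closed_curve_def)
  show ?thesis by (rule plus_of_int)
qed

lemma f_continuous_on: "continuous_on A f"
proof -
  obtain C where "C-lipschitz_on UNIV f"
    using curve by (auto simp: arclength_closed_curve_def)
  then show ?thesis
    using lipschitz_on_continuous_on continuous_on_subset by (metis subset_UNIV)
qed

lemma f_measurable [measurable]: "f \<in> borel_measurable borel"
  using f_continuous_on by (rule borel_measurable_continuous_onI)

text \<open>One fixed sequence of step sizes makes the limit Borel measurable in \<open>s\<close>;
  the value carries no information where the quotients diverge.\<close>

definition vel_lim :: "real \<Rightarrow> 'a" where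
  "vel_lim s = lim (\<lambda>n. (1 / inverse (real (Suc n))) *\<^sub>R (f (s + inverse (real (Suc n))) - f s))"

text \<open>A Borel measurable, everywhere bounded and periodic representative of the tangent.\<close>

definition vel :: "real \<Rightarrow> 'a" where
  "vel s = (if norm (vel_lim s) = 1 then vel_lim s else 0)"

lemma vel_measurable [measurable]: "vel \<in> borel_measurable borel"
  unfolding vel_def vel_lim_def by measurable

lemma vel_periodic: "vel (x + L) = vel x"
proof -
  have "f (x + L + y) = f (x + y)" for y
    using f_periodic[of "x + y"] by (simp add: add_ac)
  then show ?thesis by (simp add: vel_def vel_lim_def f_periodic)
qed

lemma norm_vel_le: "norm (vel s) \<le> 1" by (simp add: vel_def)

definition regular_point :: "real \<Rightarrow> bool" where
  "regular_point s \<longleftrightarrow> (f has_vector_derivative vel s) (at s) \<and> norm (vel s) = 1 \<and> tangent f s = vel s"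

lemma AE_regular_lebesgue: "AE s in lebesgue. regular_point s"
proof -
  have "AE s in lebesgue. f differentiable (at s) \<and> norm (tangent f s) = 1"
    using curve by (simp add: arclength_closed_curve_def unit_speed_def)
  then show ?thesis
  proof eventually_elim
    case (elim s)
    then have d: "(f has_vector_derivative tangent f s) (at s)"
      by (simp add: vector_derivative_works)
    then have "((\<lambda>h. (1 / h) *\<^sub>R (f (s + h) - f s)) \<longlongrightarrow> tangent f s) (at 0)"
      by (rule has_vector_derivative_quotient)
    moreover have "filterlim (\<lambda>n. inverse (real (Suc n))) (at 0) sequentially"
      using LIMSEQ_inverse_real_of_nat by (auto simp: filterlim_at intro!: always_eventually)
    ultimately have "(\<lambda>n. (1 / inverse (real (Suc n))) *\<^sub>R (f (s + inverse (real (Suc n))) - f s)) \<longlonglongrightarrow> tangent f s"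
      by (rule filterlim_compose)
    then have "vel_lim s = tangent f s" unfolding vel_lim_def by (rule limI)
    then show ?case using d elim by (simp add: vel_def regular_point_def)
  qed
qed

lemma AE_regular: "AE s in lborel. regular_point s"
  using AE_regular_lebesgue by (simp add: AE_completion_iff)

text \<open>Pairing with a fixed vector reduces the fundamental theorem for the curve to the scalar
  Lipschitz case.\<close>

lemma inner_vel_has_integral:
  assumes "a \<le> b"
  shows "((\<lambda>t. v \<bullet> vel t) has_integral v \<bullet> (f b - f a)) {a..b}"
proof -
  obtain C where C: "C-lipschitz_on UNIV f"
    using curve by (auto simp: arclength_closed_curve_def)
  have "(norm v * C)-lipschitz_on {a..b} (\<lambda>t. v \<bullet> f t)"
  proof (rule lipschitz_onI)
    fix x y
    have "dist (v \<bullet> f x) (v \<bullet> f y) = \<bar>v \<bullet> (f x - f y)\<bar>"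
      by (simp add: dist_real_def inner_diff_right)
    also have "\<dots> \<le> norm v * norm (f x - f y)" by (rule Cauchy_Schwarz_ineq2)
    also have "\<dots> \<le> norm v * (C * dist x y)"
      using lipschitz_onD[OF C, of x y] by (intro mult_left_mono) (auto simp: dist_norm)
    finally show "dist (v \<bullet> f x) (v \<bullet> f y) \<le> norm v * C * dist x y" by simp
  qed (use lipschitz_on_nonneg[OF C] in simp)
  moreover have "AE t in lebesgue. t \<in> {a<..<b} \<longrightarrow> ((\<lambda>t. v \<bullet> f t) has_real_derivative v \<bullet> vel t) (at t)"
    using AE_regular_lebesgue
  proof eventually_elim
    case (elim t)
    then have "(f has_vector_derivative vel t) (at t)" by (simp add: regular_point_def)
    then have "((\<lambda>t. v \<bullet> f t) has_vector_derivative v \<bullet> vel t) (at t)"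
      by (rule bounded_linear.has_vector_derivative[OF bounded_linear_inner_right])
    then show ?case by (simp add: has_real_derivative_iff_has_vector_derivative)
  qed
  ultimately show ?thesis
    using has_integral_lipschitz_derivative[OF assms] by (simp add: inner_diff_right)
qed

text \<open>The Lipschitz constant in the definition of the curve is unspecified; unit speed brings
  it down to 1. Integrate \<open>v \<bullet> vel t\<close> with \<open>v\<close> the chord vector
  itself, bound it by the norm of \<open>v\<close>, and divide.\<close>

lemma norm_f_diff_le: "norm (f s - f t) \<le> \<bar>s - t\<bar>"
proof -
  have *: "norm (f b - f a) \<le> b - a" if "a \<le> b" for a b
  proof -
    let ?v = "f b - f a"
    have "?v \<bullet> ?v \<le> integral {a..b} (\<lambda>t. norm ?v)"
    proof (rule has_integral_le[OF inner_vel_has_integral[OF that] integrable_integral])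
      show "?v \<bullet> vel t \<le> norm ?v" for t
        using norm_cauchy_schwarz[of ?v "vel t"] norm_vel_le[of t]
          mult_left_mono[OF norm_vel_le[of t] norm_ge_zero[of ?v]] by linarith
    qed auto
    then have "norm ?v * norm ?v \<le> norm ?v * (b - a)"
      using that by (simp add: dot_square_norm power2_eq_square mult.commute)
    then show ?thesis using that by (cases "norm ?v = 0") auto
  qed
  show ?thesis using *[of s t] *[of t s] by (cases "s \<le> t") (auto simp: norm_minus_commute)
qed

lemma norm_f_diff_le_circle_dist: "norm (f s - f t) \<le> circle_dist L s t"
  unfolding circle_dist_def
proof (rule cINF_greatest)
  fix k :: int
  show "norm (f s - f t) \<le> \<bar>s - t - of_int k * L\<bar>"
    using norm_f_diff_le[of s "t + of_int k * L"] by (simp add: f_periodic_int diff_diff_eq)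
qed simp

text \<open>Both sides are \<open>\<integral> 2 - 2 \<tau>(s) \<bullet> \<tau>(t) dt\<close>.\<close>

lemma tangent_deviation_integral:
  assumes s: "regular_point s" and \<epsilon>: "0 \<le> \<epsilon>"
  shows "(LINT t:{s..s + \<epsilon>}|lebesgue. (norm (tangent f s - tangent f t))\<^sup>2)
    = 2 * \<epsilon> - 2 * (vel s \<bullet> (f (s + \<epsilon>) - f s))"
proof -
  let ?h = "\<lambda>t. 2 - 2 * (vel s \<bullet> vel t)"
  let ?g = "\<lambda>t. (norm (tangent f s - tangent f t))\<^sup>2"
  define N where "N = {t. \<not> regular_point t}"
  have N: "negligible N"
    using AE_regular_lebesgue by (simp add: N_def negligible_iff_null_sets completion.AE_iff_null_sets)
  have eq: "?g t = ?h t" if "t \<in> {s..s + \<epsilon>} - N" for t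
  proof -
    have "norm (vel t) = 1" "tangent f t = vel t" "norm (vel s) = 1" "tangent f s = vel s"
      using that s by (auto simp: N_def regular_point_def)
    then show ?thesis
      by (simp add: power2_norm_eq_inner inner_diff_left inner_diff_right inner_commute)
        (simp add: dot_square_norm)
  qed
  have bd: "\<bar>?h t\<bar> \<le> 4" for t
  proof -
    have "\<bar>vel s \<bullet> vel t\<bar> \<le> norm (vel s) * norm (vel t)" by (rule Cauchy_Schwarz_ineq2)
    also have "\<dots> \<le> 1 * 1" by (intro mult_mono norm_vel_le) auto
    finally show ?thesis by linarith
  qed
  have "set_integrable lborel {s..s + \<epsilon>} ?h"
    by (rule set_integrable_lborel_bounded[OF _ _ _ bd]) auto
  then have "?h absolutely_integrable_on {s..s + \<epsilon>}"
    unfolding set_integrable_def by (subst integrable_completion) (auto simp: set_integrable_def)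
  then have "?g absolutely_integrable_on {s..s + \<epsilon>}"
    by (rule absolutely_integrable_spike[OF _ N eq])
  then have "(LINT t:{s..s + \<epsilon>}|lebesgue. ?g t) = integral {s..s + \<epsilon>} ?g"
    by (rule set_lebesgue_integral_eq_integral)
  also have "\<dots> = integral {s..s + \<epsilon>} ?h"
    by (rule integral_spike[OF N]) (use eq in auto)
  also have "(?h has_integral 2 * \<epsilon> - 2 * (vel s \<bullet> (f (s + \<epsilon>) - f s))) {s..s + \<epsilon>}"
  proof (intro has_integral_diff has_integral_mult_right inner_vel_has_integral)
    show "((\<lambda>t. 2) has_integral 2 * \<epsilon>) {s..s + \<epsilon>}"
      using has_integral_const_real[of "2::real" s "s + \<epsilon>"] \<epsilon> by (simp add: mult.commute)
  qed (use \<epsilon> in simp)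
  then have "integral {s..s + \<epsilon>} ?h = 2 * \<epsilon> - 2 * (vel s \<bullet> (f (s + \<epsilon>) - f s))"
    by (rule integral_unique)
  finally show ?thesis .
qed

section \<open>The curve traversed backwards\<close>

lemma reversed_has_derivative:
  assumes "regular_point (- s)"
  shows "((\<lambda>s. f (- s)) has_vector_derivative - vel (- s)) (at s)"
proof -
  have "(f has_vector_derivative vel (- s)) (at (- s))"
    using assms by (simp add: regular_point_def)
  then have "((f \<circ> uminus) has_vector_derivative (- 1) *\<^sub>R vel (- s)) (at s)"
    by (intro vector_diff_chain_at) (auto intro!: derivative_eq_intros)
  then show ?thesis by (simp add: o_def)
qed

lemma reversed_arclength_curve: "arclength_curve L (\<lambda>s. f (- s))"
proof
  show "arclength_closed_curve L (\<lambda>s. f (- s))"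
    unfolding arclength_closed_curve_def
  proof (intro conjI)
    show "periodic_fun_simple (\<lambda>s. f (- s)) L"
    proof
      show "f (- (x + L)) = f (- x)" for x
        using f_periodic[of "- x - L"] by simp
    qed
    show "\<exists>C. C-lipschitz_on UNIV (\<lambda>s. f (- s))"
      by (rule exI[of _ 1], rule lipschitz_onI)
        (use norm_f_diff_le[of "- x" "- y" for x y] in \<open>auto simp: dist_norm abs_minus_commute\<close>)
    have "AE s in lborel. regular_point (- s)" using AE_regular by (rule AE_lborel_uminus)
    then have "AE s in lebesgue. regular_point (- s)" by (rule AE_completion)
    then show "unit_speed (\<lambda>s. f (- s))"
      unfolding unit_speed_def
    proof eventually_elim
      case (elim s)
      from reversed_has_derivative[OF this]
      have "(\<lambda>s. f (- s)) differentiable (at s)" "tangent (\<lambda>s. f (- s)) s = - vel (- s)"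
        by (auto intro: differentiableI_vector vector_derivative_at)
      then show ?case using elim by (simp add: regular_point_def)
    qed
  qed
qed (rule L_pos)

text \<open>The representative of the reversed curve is built from quotients of \<open>f\<close> on
  the other side, so the two agree only where \<open>f\<close> is differentiable, hence almost
  everywhere.\<close>

lemma AE_reversed_vel: "AE s in lborel. arclength_curve.vel (\<lambda>s. f (- s)) s = - vel (- s)"
proof -
  interpret rev: arclength_curve L "\<lambda>s. f (- s)" by (rule reversed_arclength_curve)
  have "AE s in lborel. regular_point (- s)" using AE_regular by (rule AE_lborel_uminus)
  then show ?thesis using rev.AE_regular
  proof eventually_elim
    case (elim s)
    then have "((\<lambda>s. f (- s)) has_vector_derivative rev.vel s) (at s)"
      by (simp add: rev.regular_point_def)
    then show ?case
      by (rule vector_derivative_unique_at[OF _ reversed_has_derivative[OF elim(1)]])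
  qed
qed

end

section \<open>Boundary terms\<close>

text \<open>The lower bi-Lipschitz constant is fixed as \<open>c\<close>; the matching upper bound,
  with constant 1, is \<open>norm_f_diff_le_circle_dist\<close>.\<close>

locale bilipschitz_curve = energy_weight \<Phi> + arclength_curve L f
  for \<Phi> L and f :: "real \<Rightarrow> 'a::euclidean_space" +
  fixes c :: real
  assumes c_pos: "0 < c" and lower: "c * circle_dist L s t \<le> norm (f s - f t)"
begin

lemma reversed_bilipschitz_curve: "bilipschitz_curve \<Phi> L (\<lambda>s. f (- s)) c"
proof -
  interpret rev: arclength_curve L "\<lambda>s. f (- s)" by (rule reversed_arclength_curve)
  show ?thesis
    by unfold_locales (use c_pos lower[of "- s" "- t" for s t] in \<open>auto simp: circle_dist_minus\<close>)
qed

abbreviation chord :: "real \<Rightarrow> real \<Rightarrow> real" where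
  "chord s t \<equiv> norm (f s - f t)"

text \<open>The primitive in \<open>t\<close> whose values at the ends of
  \<open>{s + \<epsilon>..s + L - \<epsilon>}\<close> are the boundary terms.\<close>

definition chord_term :: "real \<Rightarrow> real \<Rightarrow> real" where
  "chord_term s t = Lam \<Phi> (chord s t) * (vel s \<bullet> (f s - f t))"

lemma chord_term_measurable [measurable]:
  assumes [measurable]: "u \<in> borel_measurable M" "v \<in> borel_measurable M"
  shows "(\<lambda>x. chord_term (u x) (v x)) \<in> borel_measurable M"
  unfolding chord_term_def by measurable

lemma chord_le_half: "chord s t \<le> L / 2" if "\<bar>s - t\<bar> \<le> L"
  using norm_f_diff_le_circle_dist[of s t] circle_dist_eq[OF that] by linarith

lemma inner_vel_le: "\<bar>vel s \<bullet> x\<bar> \<le> norm x"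
proof -
  have "\<bar>vel s \<bullet> x\<bar> \<le> norm (vel s) * norm x" by (rule Cauchy_Schwarz_ineq2)
  also have "\<dots> \<le> 1 * norm x" by (intro mult_right_mono norm_vel_le) auto
  finally show ?thesis by simp
qed

lemma chord_term_bound:
  assumes "0 < \<epsilon>" "\<epsilon> \<le> circle_dist L s t"
  shows "\<bar>Lam \<Phi> (chord s t)\<bar> \<le> tail_integral \<Phi> (c * \<epsilon>) / (c * \<epsilon>)"
    and "\<bar>chord_term s t\<bar> \<le> tail_integral \<Phi> (c * \<epsilon>) / (c * \<epsilon>) * \<bar>s - t\<bar>"
    and "c * \<epsilon> \<le> chord s t"
proof -
  show le: "c * \<epsilon> \<le> chord s t"
    using lower[of s t] mult_left_mono[OF assms(2), of c] c_pos by linarith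
  show bd: "\<bar>Lam \<Phi> (chord s t)\<bar> \<le> tail_integral \<Phi> (c * \<epsilon>) / (c * \<epsilon>)"
    by (rule Lam_bound[OF _ le]) (use assms c_pos in auto)
  have "\<bar>vel s \<bullet> (f s - f t)\<bar> \<le> \<bar>s - t\<bar>"
    using inner_vel_le[of s "f s - f t"] norm_f_diff_le[of s t] by linarith
  then show "\<bar>chord_term s t\<bar> \<le> tail_integral \<Phi> (c * \<epsilon>) / (c * \<epsilon>) * \<bar>s - t\<bar>"
    unfolding chord_term_def abs_mult by (intro mult_mono bd) (use bd in linarith)+
qed

lemma edge_integrable:
  assumes "0 < \<epsilon>" "\<epsilon> < L"
  shows "set_integrable lborel {0..<L} (\<lambda>s. Lam \<Phi> (chord s (s + \<epsilon>)))"
    and "set_integrable lborel {0..<L} (\<lambda>s. chord_term s (s + \<epsilon>))"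
    and "set_integrable lborel {0..<L} (\<lambda>s. chord_term s (s - \<epsilon>))"
proof -
  \<comment> \<open>This is the exact circle distance from \<open>s\<close> to each of
    \<open>s + \<epsilon>\<close> and \<open>s - \<epsilon>\<close>, and it stays positive for all
    \<open>\<epsilon>\<close> below \<open>L\<close>.\<close>
  define m where "m = min \<epsilon> (L - \<epsilon>)"
  have m: "0 < m" "m \<le> circle_dist L s (s + \<epsilon>)" "m \<le> circle_dist L s (s - \<epsilon>)" for s
    using assms by (auto simp: m_def circle_dist_eq)
  show "set_integrable lborel {0..<L} (\<lambda>s. Lam \<Phi> (chord s (s + \<epsilon>)))"
    by (rule set_integrable_lborel_bounded[OF _ _ _ chord_term_bound(1)[OF m(1) m(2)]]) auto
  show "set_integrable lborel {0..<L} (\<lambda>s. chord_term s (s + \<epsilon>))"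
    by (rule set_integrable_lborel_bounded[of _ _ "tail_integral \<Phi> (c * m) / (c * m) * \<epsilon>"])
      (use chord_term_bound(2)[OF m(1) m(2)] assms in auto)
  show "set_integrable lborel {0..<L} (\<lambda>s. chord_term s (s - \<epsilon>))"
    by (rule set_integrable_lborel_bounded[of _ _ "tail_integral \<Phi> (c * m) / (c * m) * \<epsilon>"])
      (use chord_term_bound(2)[OF m(1) m(3)] assms in auto)
qed

text \<open>The conclusion of (A.4) for this curve. Stated inside the locale, it is available for
  the reversed curve by interpretation.\<close>

definition Lam_condition :: bool where
  "Lam_condition \<longleftrightarrow>
     ((\<lambda>\<epsilon>. \<epsilon> * (LINT s|circle_measure L. Lam \<Phi> (chord s (s + \<epsilon>)) - Lam \<Phi> \<epsilon>)) \<longlongrightarrow> 0) (at_right 0)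
   \<and> ((\<lambda>\<epsilon>. LINT s1|circle_measure L. Lam \<Phi> (chord s1 (s1 + \<epsilon>)) *
        (LINT s2:{s1..s1 + \<epsilon>}|lebesgue. (norm (tangent f s1 - tangent f s2))\<^sup>2)) \<longlongrightarrow> 0) (at_right 0)"

text \<open>With \<open>A\<close> and \<open>B\<close> the two quantities of (A.4),
  \<open>A \<epsilon> - B \<epsilon> / 2\<close> equals the expression exactly:
  \<open>\<epsilon>\<close> times the integral of \<open>Lam \<Phi>\<close> along the chords occurs
  in both and cancels, while \<open>\<epsilon> * Lam \<Phi> \<epsilon>\<close> is minus the
  tail.\<close>

lemma right_edge_limit:
  assumes "Lam_condition"
  shows "((\<lambda>\<epsilon>. L * tail_integral \<Phi> \<epsilon> - (LINT s:{0..<L}|lborel. chord_term s (s + \<epsilon>))) \<longlongrightarrow> 0) (at_right 0)"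
proof -
  define A where "A \<epsilon> = \<epsilon> * (LINT s|circle_measure L. Lam \<Phi> (chord s (s + \<epsilon>)) - Lam \<Phi> \<epsilon>)" for \<epsilon>
  define B where "B \<epsilon> = (LINT s1|circle_measure L. Lam \<Phi> (chord s1 (s1 + \<epsilon>)) *
        (LINT s2:{s1..s1 + \<epsilon>}|lebesgue. (norm (tangent f s1 - tangent f s2))\<^sup>2))" for \<epsilon>
  have "((\<lambda>\<epsilon>. A \<epsilon> - B \<epsilon> / 2) \<longlongrightarrow> 0 - 0 / 2) (at_right 0)"
    using assms unfolding Lam_condition_def A_def B_def by (intro tendsto_intros) auto
  moreover have "\<forall>\<^sub>F \<epsilon> in at_right 0. A \<epsilon> - B \<epsilon> / 2 =
      L * tail_integral \<Phi> \<epsilon> - (LINT s:{0..<L}|lborel. chord_term s (s + \<epsilon>))"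
    unfolding eventually_at_right_field
  proof (intro exI[of _ L] conjI L_pos allI impI)
    fix \<epsilon> :: real assume \<epsilon>: "0 < \<epsilon>" "\<epsilon> < L"
    note int = edge_integrable[OF \<epsilon>]
    define I where "I = (LINT s:{0..<L}|lborel. Lam \<Phi> (chord s (s + \<epsilon>)))"
    define J where "J = (LINT s:{0..<L}|lborel. chord_term s (s + \<epsilon>))"
    have c_int: "set_integrable lborel {0..<L} (\<lambda>s. Lam \<Phi> \<epsilon>)"
      by (rule set_integrable_lborel_bounded) auto
    have "(LINT s|circle_measure L. Lam \<Phi> (chord s (s + \<epsilon>)) - Lam \<Phi> \<epsilon>)
        = (LINT s:{0..<L}|lborel. Lam \<Phi> (chord s (s + \<epsilon>)) - Lam \<Phi> \<epsilon>)"
      by (rule integral_lebesgue_on_AE_borel) (auto intro!: always_eventually)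
    also have "\<dots> = I - (LINT s:{0..<L}|lborel. Lam \<Phi> \<epsilon>)"
      unfolding I_def by (rule set_integral_diff[OF int(1) c_int])
    also have "(LINT s:{0..<L}|lborel. Lam \<Phi> \<epsilon>) = L * Lam \<Phi> \<epsilon>"
      using L_pos by (simp add: set_integral_const)
    finally have A: "A \<epsilon> = \<epsilon> * (I - L * Lam \<Phi> \<epsilon>)" by (simp add: A_def)
    \<comment> \<open>The deviation integral contains \<open>f (s + \<epsilon>) - f s\<close>, but
      \<open>chord_term\<close> contains the opposite difference; this accounts for the plus
      sign.\<close>
    have "B \<epsilon> = (LINT s:{0..<L}|lborel. 2 * \<epsilon> * Lam \<Phi> (chord s (s + \<epsilon>)) + 2 * chord_term s (s + \<epsilon>))"
      unfolding B_def
    proof (rule integral_lebesgue_on_AE_borel)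
      show "AE s in lborel. s \<in> {0..<L} \<longrightarrow> Lam \<Phi> (chord s (s + \<epsilon>)) *
          (LINT s2:{s..s + \<epsilon>}|lebesgue. (norm (tangent f s - tangent f s2))\<^sup>2)
          = 2 * \<epsilon> * Lam \<Phi> (chord s (s + \<epsilon>)) + 2 * chord_term s (s + \<epsilon>)"
        using AE_regular
      proof eventually_elim
        case (elim s)
        then show ?case
          using tangent_deviation_integral[OF elim, of \<epsilon>] \<epsilon>
          by (simp add: chord_term_def inner_diff_right) (simp add: algebra_simps)
      qed
    qed auto
    also have "\<dots> = 2 * \<epsilon> * I + 2 * J"
      unfolding I_def J_def using int by (subst set_integral_add) auto
    finally show "A \<epsilon> - B \<epsilon> / 2 = L * tail_integral \<Phi> \<epsilon> - J"
      unfolding A using \<epsilon> by (simp add: Lam_def field_simps)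
  qed
  ultimately show ?thesis using tendsto_cong by force
qed

text \<open>\<open>Lam_condition\<close> measures the deviation from the tangent at the initial point of the arc of length
  \<open>\<epsilon>\<close>; here the tangent at its end point occurs, which is the initial point for the reversed curve.\<close>

lemma left_edge_limit:
  assumes "bilipschitz_curve.Lam_condition \<Phi> L (\<lambda>s. f (- s))"
  shows "((\<lambda>\<epsilon>. L * tail_integral \<Phi> \<epsilon> + (LINT s:{0..<L}|lborel. chord_term s (s - \<epsilon>))) \<longlongrightarrow> 0) (at_right 0)"
proof -
  interpret rev: bilipschitz_curve \<Phi> L "\<lambda>s. f (- s)" c by (rule reversed_bilipschitz_curve)
  have "(LINT s:{0..<L}|lborel. rev.chord_term s (s + \<epsilon>)) = - (LINT s:{0..<L}|lborel. chord_term s (s - \<epsilon>))" for \<epsilon>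
  proof -
    have "(LINT s:{0..<L}|lborel. rev.chord_term s (s + \<epsilon>)) = (LINT s:{0..<L}|lborel. - chord_term (- s) (- s - \<epsilon>))"
    proof (rule set_lebesgue_integral_cong_AE)
      show "AE s\<in>{0..<L} in lborel. rev.chord_term s (s + \<epsilon>) = - chord_term (- s) (- s - \<epsilon>)"
        using AE_reversed_vel by (auto simp: rev.chord_term_def chord_term_def elim!: eventually_mono)
    qed auto
    also have "\<dots> = (LINT s:{0..<L}|lborel. - chord_term s (s - \<epsilon>))"
    proof (rule periodic_set_integral_reflect)
      show "- chord_term (x + L) (x + L - \<epsilon>) = - chord_term x (x - \<epsilon>)" for x
        using f_periodic[of "x - \<epsilon>"]
        by (simp add: chord_term_def f_periodic vel_periodic diff_add_eq)
    qed
    finally show ?thesis by (simp add: set_lebesgue_integral_def)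
  qed
  then show ?thesis using rev.right_edge_limit[OF assms] by simp
qed

section \<open>The integrand\<close>

text \<open>\<open>sgn\<close> vanishes at zero, so the norm is at most 1 even at coincident
  points.\<close>

definition direction :: "real \<Rightarrow> real \<Rightarrow> 'a" where
  "direction s t = sgn (f s - f t)"

text \<open>The angle integrand with both cosines expressed by tangents and chord.
  \<open>Theta\<close> disappears through \<open>1 - 2 * Theta = - \<Phi> * Lam\<close> and
  \<open>2 * (1 - Theta) = 1 - \<Phi> * Lam\<close>; the use of \<open>recip\<close> and
  \<open>vel\<close> makes the result Borel measurable.\<close>

definition kernel :: "real \<Rightarrow> real \<Rightarrow> real" where
  "kernel s t = recip (chord s t) - Lam \<Phi> (chord s t) * (vel s \<bullet> vel t)
     - (recip (chord s t) - Lam \<Phi> (chord s t)) * (vel s \<bullet> direction s t) * (vel t \<bullet> direction s t)"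

lemma kernel_measurable [measurable]:
  assumes [measurable]: "u \<in> borel_measurable M" "v \<in> borel_measurable M"
  shows "(\<lambda>x. kernel (u x) (v x)) \<in> borel_measurable M"
  unfolding kernel_def direction_def sgn_div_norm by measurable

lemma kernel_periodic: "kernel s (t + L) = kernel s t"
  by (simp add: kernel_def direction_def f_periodic vel_periodic)

lemma kernel_bound:
  assumes "0 < \<epsilon>" "\<epsilon> \<le> circle_dist L s t"
  shows "\<bar>recip (chord s t)\<bar> \<le> recip (c * \<epsilon>)"
    and "\<bar>kernel s t\<bar> \<le> 2 * recip (c * \<epsilon>) + 2 * (tail_integral \<Phi> (c * \<epsilon>) / (c * \<epsilon>))"
proof -
  note bd = chord_term_bound[OF assms]
  show r: "\<bar>recip (chord s t)\<bar> \<le> recip (c * \<epsilon>)"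
    using recip_antimono[OF _ bd(3)] recip_nonneg c_pos assms by simp
  let ?\<Lambda> = "Lam \<Phi> (chord s t)" and ?r = "recip (chord s t)"
  have "\<bar>vel s \<bullet> vel t\<bar> \<le> 1"
    using inner_vel_le[of s "vel t"] norm_vel_le[of t] by linarith
  then have 1: "\<bar>?\<Lambda> * (vel s \<bullet> vel t)\<bar> \<le> \<bar>?\<Lambda>\<bar>"
    by (simp add: abs_mult mult_left_le)
  have "norm (direction s t) \<le> 1" by (simp add: direction_def norm_sgn)
  then have "\<bar>vel u \<bullet> direction s t\<bar> \<le> 1" for u
    using inner_vel_le[of u "direction s t"] by linarith
  then have "\<bar>(vel s \<bullet> direction s t) * (vel t \<bullet> direction s t)\<bar> \<le> 1"
    by (simp add: abs_mult mult_le_one)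
  then have 2: "\<bar>(?r - ?\<Lambda>) * (vel s \<bullet> direction s t) * (vel t \<bullet> direction s t)\<bar> \<le> \<bar>?r - ?\<Lambda>\<bar>"
    by (simp add: abs_mult mult.assoc mult_left_le)
  show "\<bar>kernel s t\<bar> \<le> 2 * recip (c * \<epsilon>) + 2 * (tail_integral \<Phi> (c * \<epsilon>) / (c * \<epsilon>))"
    unfolding kernel_def using 1 2 r bd(1) by linarith
qed

text \<open>Away from the diagonal both factors are bounded and Lipschitz in \<open>t\<close>:
  \<open>Lam \<Phi>\<close> of the chord is bounded by \<open>T\<close> with constant
  \<open>K\<close>, the inner product is bounded by \<open>L\<close> with constant 1.\<close>

lemma chord_term_lipschitz:
  assumes \<epsilon>: "0 < \<epsilon>" "\<epsilon> < L / 2"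
  shows "\<exists>K. K-lipschitz_on {s + \<epsilon>..s + L - \<epsilon>} (chord_term s)"
proof -
  define K where "K = recip (c * \<epsilon>) / (c * \<epsilon>) + tail_integral \<Phi> (c * \<epsilon>) / (c * \<epsilon>)\<^sup>2"
  define T where "T = tail_integral \<Phi> (c * \<epsilon>) / (c * \<epsilon>)"
  have c\<epsilon>: "0 < c * \<epsilon>" using c_pos \<epsilon> by simp
  have K: "K-lipschitz_on {c * \<epsilon>..} (Lam \<Phi>)" unfolding K_def by (rule Lam_lipschitz[OF c\<epsilon>])
  have K0: "0 \<le> K" using K by (rule lipschitz_on_nonneg)
  have T0: "0 \<le> T" unfolding T_def using tail_nonneg[OF c\<epsilon>] c\<epsilon> by simp
  have "(K * L + T)-lipschitz_on {s + \<epsilon>..s + L - \<epsilon>} (chord_term s)"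
  proof (rule lipschitz_onI)
    fix x y assume xy: "x \<in> {s + \<epsilon>..s + L - \<epsilon>}" "y \<in> {s + \<epsilon>..s + L - \<epsilon>}"
    have d: "\<epsilon> \<le> circle_dist L s x" "\<epsilon> \<le> circle_dist L s y"
      using xy \<epsilon> by (auto simp: circle_dist_eq)
    note bx = chord_term_bound[OF \<epsilon>(1) d(1)] and bY = chord_term_bound[OF \<epsilon>(1) d(2)]
    have fxy: "norm (f y - f x) \<le> dist x y" 
      using norm_f_diff_le[of y x] by (simp add: dist_real_def abs_minus_commute)
    have "\<bar>Lam \<Phi> (chord s x) - Lam \<Phi> (chord s y)\<bar> \<le> K * \<bar>chord s x - chord s y\<bar>"
      using lipschitz_onD[OF K, of "chord s x" "chord s y"] bx(3) bY(3) by (simp add: dist_real_def)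
    also have "\<dots> \<le> K * dist x y"
      using norm_triangle_ineq3[of "f s - f x" "f s - f y"] fxy K0 by (intro mult_left_mono) auto
    finally have 1: "\<bar>Lam \<Phi> (chord s x) - Lam \<Phi> (chord s y)\<bar> \<le> K * dist x y" .
    have 2: "\<bar>vel s \<bullet> (f s - f x)\<bar> \<le> L"
      using inner_vel_le[of s "f s - f x"] norm_f_diff_le[of s x] xy \<epsilon> by auto
    have 3: "\<bar>vel s \<bullet> (f y - f x)\<bar> \<le> dist x y"
      using inner_vel_le[of s "f y - f x"] fxy by linarith
    have "chord_term s x - chord_term s y
        = (Lam \<Phi> (chord s x) - Lam \<Phi> (chord s y)) * (vel s \<bullet> (f s - f x))
          + Lam \<Phi> (chord s y) * (vel s \<bullet> (f y - f x))"
      by (simp add: chord_term_def inner_diff_right algebra_simps)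
    then have "dist (chord_term s x) (chord_term s y)
        \<le> \<bar>(Lam \<Phi> (chord s x) - Lam \<Phi> (chord s y)) * (vel s \<bullet> (f s - f x))\<bar>
          + \<bar>Lam \<Phi> (chord s y) * (vel s \<bullet> (f y - f x))\<bar>"
      by (simp add: dist_real_def)
    also have "\<dots> \<le> K * dist x y * L + T * dist x y"
      unfolding abs_mult using 1 2 3 bY(1) K0 T0
      by (intro add_mono mult_mono) (auto simp: T_def)
    finally show "dist (chord_term s x) (chord_term s y) \<le> (K * L + T) * dist x y"
      by (simp add: algebra_simps)
  qed (use K0 T0 L_pos in simp)
  then show ?thesis by blast
qed

lemma chord_has_derivative:
  assumes t: "regular_point t" and ne: "f s \<noteq> f t"
  shows "(chord s has_real_derivative - (vel t \<bullet> direction s t)) (at t)"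
proof -
  have "(f has_derivative (\<lambda>h. h *\<^sub>R vel t)) (at t)"
    using t by (simp add: regular_point_def has_vector_derivative_def)
  then have "((\<lambda>t. f s - f t) has_derivative (\<lambda>h. 0 - h *\<^sub>R vel t)) (at t)"
    by (intro has_derivative_diff has_derivative_const)
  moreover have "(norm has_derivative (\<lambda>h. h \<bullet> sgn (f s - f t))) (at (f s - f t))"
    using ne by (intro has_derivative_norm) auto
  ultimately have "((\<lambda>t. norm (f s - f t)) has_derivative (\<lambda>h. (0 - h *\<^sub>R vel t) \<bullet> sgn (f s - f t))) (at t)"
    by (rule has_derivative_compose)
  moreover have "(\<lambda>h. (0 - h *\<^sub>R vel t) \<bullet> sgn (f s - f t)) = (*) (- (vel t \<bullet> direction s t))"
    by (auto simp: direction_def)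
  ultimately show ?thesis
    by (simp add: has_field_derivative_def)
qed

text \<open>The product rule gives the derivative of \<open>chord_term s\<close>. The factor
  \<open>1 / r\<close> in the derivative of \<open>Lam \<Phi>\<close> cancels against
  \<open>f s - f t = r\<close> times \<open>direction s t\<close>, which produces the product of the
  two directional components.\<close>

lemma kernel_has_integral:
  assumes \<epsilon>: "0 < \<epsilon>" "\<epsilon> < L / 2"
  shows "((\<lambda>t. kernel s t - recip (chord s t)) has_integral
      chord_term s (s + L - \<epsilon>) - chord_term s (s + \<epsilon>)) {s + \<epsilon>..s + L - \<epsilon>}"
proof -
  obtain K where K: "K-lipschitz_on {s + \<epsilon>..s + L - \<epsilon>} (chord_term s)"
    using chord_term_lipschitz[OF \<epsilon>] by blast
  \<comment> \<open>The chain rule asks for values strictly above \<open>\<rho>\<close>, and halving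
    the lower bound \<open>c * \<epsilon>\<close> of the chord provides this.\<close>
  define \<rho> where "\<rho> = c * \<epsilon> / 2"
  have \<rho>: "0 < \<rho>" using c_pos \<epsilon> by (simp add: \<rho>_def)
  let ?A = "{s + \<epsilon><..<s + L - \<epsilon>}" and ?h = "\<lambda>x. (recip x - Lam \<Phi> x) / x"
  have gt: "\<rho> < chord s t" if "t \<in> ?A" for t
  proof -
    have "\<epsilon> \<le> circle_dist L s t" using that \<epsilon> by (auto simp: circle_dist_eq)
    then have "c * \<epsilon> \<le> chord s t" by (rule chord_term_bound(3)[OF \<epsilon>(1)])
    then show ?thesis using \<rho> by (simp add: \<rho>_def)
  qed
  have chord_der: "AE t in lebesgue. t \<in> ?A \<longrightarrow> (chord s has_real_derivative - (vel t \<bullet> direction s t)) (at t)"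
    using AE_regular_lebesgue
  proof eventually_elim
    case (elim t)
    then show ?case using chord_has_derivative[OF elim, of s] gt[of t] \<rho> by fastforce
  qed
  have "AE t in lebesgue. t \<in> ?A \<longrightarrow> ((\<lambda>t. Lam \<Phi> (chord s t)) has_real_derivative
      ?h (chord s t) * - (vel t \<bullet> direction s t)) (at t)"
  proof (rule AE_chain_rule_lipschitz[OF _ countable_recip_discont _ chord_der gt])
    show "(recip \<rho> / \<rho> + tail_integral \<Phi> \<rho> / \<rho>\<^sup>2)-lipschitz_on {\<rho><..} (Lam \<Phi>)"
      using Lam_lipschitz[OF \<rho>] by (rule lipschitz_on_subset) auto
    show "(Lam \<Phi> has_real_derivative ?h x) (at x)"
      if "\<rho> < x" "x \<notin> {x. 0 < x \<and> \<not> isCont recip x}" for x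
      using that \<rho> by (intro Lam_has_derivative) auto
  qed
  then have der: "AE t in lebesgue. t \<in> ?A \<longrightarrow>
      (chord_term s has_real_derivative kernel s t - recip (chord s t)) (at t)"
    using AE_regular_lebesgue
  proof eventually_elim
    case (elim t)
    show ?case
    proof
      assume t: "t \<in> ?A"
      have "(f has_vector_derivative vel t) (at t)" using elim(2) by (simp add: regular_point_def)
      then have "((\<lambda>t. f s - f t) has_vector_derivative 0 - vel t) (at t)"
        by (intro has_vector_derivative_diff has_vector_derivative_const)
      then have "((\<lambda>t. vel s \<bullet> (f s - f t)) has_vector_derivative vel s \<bullet> (0 - vel t)) (at t)"
        by (rule bounded_linear.has_vector_derivative[OF bounded_linear_inner_right])
      then have "((\<lambda>t. vel s \<bullet> (f s - f t)) has_real_derivative - (vel s \<bullet> vel t)) (at t)"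
        by (simp add: has_real_derivative_iff_has_vector_derivative)
      from DERIV_mult[OF elim(1)[rule_format, OF t] this]
      have "(chord_term s has_real_derivative
          ?h (chord s t) * - (vel t \<bullet> direction s t) * (vel s \<bullet> (f s - f t))
          + - (vel s \<bullet> vel t) * Lam \<Phi> (chord s t)) (at t)"
        by (simp add: chord_term_def[abs_def])
      moreover have "f s - f t = chord s t *\<^sub>R direction s t"
        by (cases "f s = f t") (auto simp: direction_def sgn_div_norm)
      then have "vel s \<bullet> (f s - f t) = chord s t * (vel s \<bullet> direction s t)"
        by (metis inner_scaleR_right)
      then have "?h (chord s t) * - (vel t \<bullet> direction s t) * (vel s \<bullet> (f s - f t))
          + - (vel s \<bullet> vel t) * Lam \<Phi> (chord s t) = kernel s t - recip (chord s t)"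
        using gt[OF t] \<rho> by (cases "f s = f t") (auto simp: kernel_def)
      ultimately show "(chord_term s has_real_derivative kernel s t - recip (chord s t)) (at t)"
        by simp
    qed
  qed
  show ?thesis
    by (rule has_integral_lipschitz_derivative[OF _ K der]) (use \<epsilon> in auto)
qed

section \<open>The energy as an integral of a nonnegative Borel function\<close>

definition gap :: "real \<times> real \<Rightarrow> real" where
  "gap p = recip (chord (fst p) (snd p)) - recip (circle_dist L (fst p) (snd p))"

lemma gap_measurable [measurable]: "gap \<in> borel_measurable borel"
proof -
  have "gap \<in> borel_measurable (borel \<Otimes>\<^sub>M borel)"
    unfolding gap_def by measurable
  then show ?thesis by (simp add: borel_prod)
qed

lemma kernel_measurable_borel: "(\<lambda>p. kernel (fst p) (snd p)) \<in> borel_measurable borel"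
proof -
  have "(\<lambda>p. kernel (fst p) (snd p)) \<in> borel_measurable (borel \<Otimes>\<^sub>M borel)"
    by measurable
  then show ?thesis by (simp add: borel_prod)
qed

lemma chord_pos: "0 < circle_dist L s t \<Longrightarrow> 0 < chord s t"
  using lower[of s t] mult_pos_pos[OF c_pos, of "circle_dist L s t"] by linarith

text \<open>The chord is no longer than the arc and \<open>recip\<close> decreases on the positive
  reals. At distance zero the default \<open>recip 0 = 0\<close> removes the subtracted
  term.\<close>

lemma gap_nonneg: "0 \<le> gap p"
proof (cases "circle_dist L (fst p) (snd p) = 0")
  case True
  moreover have "recip 0 = 0" by (simp add: recip_def)
  ultimately show ?thesis by (simp add: gap_def recip_nonneg)
next
  case False
  then have "0 < circle_dist L (fst p) (snd p)"
    using circle_dist_nonneg[of L "fst p" "snd p"] by simp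
  then show ?thesis
    using recip_antimono[OF chord_pos norm_f_diff_le_circle_dist] by (simp add: gap_def)
qed

lemma circle_dist_pos: "s \<in> {0..<L} \<Longrightarrow> t \<in> {0..<L} \<Longrightarrow> s \<noteq> t \<Longrightarrow> 0 < circle_dist L s t"
  by (auto simp: circle_dist_eq)

lemma square_borel: "{0..<L} \<times> {0..<L} \<in> sets (borel :: (real \<times> real) measure)"
  by (intro borel_Times) auto

lemma energy_eq:
  "energy \<Phi> L f = (\<integral>\<^sup>+ p. ennreal (gap p) * indicator ({0..<L} \<times> {0..<L}) p \<partial>lborel)"
  unfolding energy_def split_def
proof (rule nn_integral_lebesgue_on_AE_borel[OF gap_measurable square_borel])
  show "AE p in lborel. p \<in> {0..<L} \<times> {0..<L} \<longrightarrow>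
      1 / \<Phi> (norm (f (fst p) - f (snd p))) - 1 / \<Phi> (circle_dist L (fst p) (snd p)) = gap p"
    using AE_lborel_fst_neq_snd
    by (rule eventually_mono)
      (use circle_dist_pos chord_pos[OF circle_dist_pos] in \<open>auto simp: gap_def recip_def\<close>)
qed

text \<open>The point reflection \<open>p\<close> to \<open>(L, L) - p\<close> preserves area and
  carries the gap of \<open>f\<close> to that of the reversed curve, by periodicity. The finite
  energy that follows is what (A.3) asks of the reversed curve.\<close>

lemma energy_reversed: "energy \<Phi> L (\<lambda>s. f (- s)) = energy \<Phi> L f"
proof -
  interpret rev: bilipschitz_curve \<Phi> L "\<lambda>s. f (- s)" c by (rule reversed_bilipschitz_curve)
  let ?S = "{0..<L} \<times> {0..<L}" and ?T = "\<lambda>p :: real \<times> real. (L, L) + (-1) *\<^sub>R p"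
  have S [measurable]: "?S \<in> sets borel" by (rule square_borel)
  have gap: "gap (?T p) = rev.gap p" for p
  proof -
    have "f (L - x) = f (- x)" for x using f_periodic[of "- x"] by (simp add: add.commute)
    moreover have "circle_dist L (L - x) (L - y) = circle_dist L x y" for x y
      using circle_dist_minus[of L "x - L" "y - L"] by (simp add: circle_dist_def)
    ultimately show ?thesis by (simp add: gap_def rev.gap_def fst_add snd_add)
  qed
  have "energy \<Phi> L f = (\<integral>\<^sup>+ p. ennreal (gap p) * indicator ?S p
      \<partial>density (distr lborel borel ?T) (\<lambda>_. ennreal (\<bar>- 1\<bar> ^ DIM(real \<times> real))))"
    unfolding energy_eq by (subst lborel_affine[of "-1" "(L, L)"]) simp_all
  also have "\<dots> = (\<integral>\<^sup>+ p. ennreal (gap (?T p)) * indicator ?S (?T p) \<partial>lborel)"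
    by (simp add: nn_integral_density nn_integral_distr)
  also have "\<dots> = (\<integral>\<^sup>+ p. ennreal (rev.gap p) * indicator ?S p \<partial>lborel)"
  proof (rule nn_integral_cong_AE)
    \<comment> \<open>The reflected half-open square differs from the original only at points having
      a coordinate \<open>0\<close> or \<open>L\<close>.\<close>
    have "AE x in lborel. (x :: real) \<noteq> 0 \<and> x \<noteq> L"
      using AE_lborel_singleton[of "0 :: real"] AE_lborel_singleton[of L] by eventually_elim auto
    from AE_lborel_fst_snd[OF this]
    show "AE p in lborel. ennreal (gap (?T p)) * indicator ?S (?T p) = ennreal (rev.gap p) * indicator ?S p"
      unfolding gap by (rule eventually_mono) (auto simp: indicator_def mem_Times_iff)
  qed
  also have "\<dots> = energy \<Phi> L (\<lambda>s. f (- s))" by (rule rev.energy_eq[symmetric])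
  finally show ?thesis ..
qed

lemma
  assumes "energy \<Phi> L f < \<infinity>"
  shows gap_integrable: "set_integrable lborel ({0..<L} \<times> {0..<L}) gap"
    and gap_integral: "(LINT p:{0..<L} \<times> {0..<L}|lborel. gap p) = enn2real (energy \<Phi> L f)"
proof -
  let ?h = "\<lambda>p. indicator ({0..<L} \<times> {0..<L}) p *\<^sub>R gap p"
  have S [measurable]: "{0..<L} \<times> {0..<L} \<in> sets (borel :: (real \<times> real) measure)" by (rule square_borel)
  have eq: "(\<integral>\<^sup>+ p. ennreal (?h p) \<partial>lborel) = energy \<Phi> L f"
    unfolding energy_eq by (intro nn_integral_cong) (auto simp: indicator_def)
  have nn: "0 \<le> ?h p" for p using gap_nonneg by simp
  show "set_integrable lborel ({0..<L} \<times> {0..<L}) gap"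
    unfolding set_integrable_def
  proof (rule integrableI_nonneg)
    show "AE p in lborel. 0 \<le> ?h p" using nn by (rule AE_I2)
    show "(\<integral>\<^sup>+ p. ennreal (?h p) \<partial>lborel) < \<infinity>" unfolding eq by (rule assms)
  qed measurable
  show "(LINT p:{0..<L} \<times> {0..<L}|lborel. gap p) = enn2real (energy \<Phi> L f)"
    unfolding set_lebesgue_integral_def 
    by (subst integral_eq_nn_integral) (use nn in \<open>auto simp only: eq intro!: AE_I2\<close>, measurable)
qed

text \<open>The nonnegative integrable gap dominates its own restrictions, and every pair off the
  diagonal eventually belongs to the cut-off region.\<close>

lemma gap_limit:
  assumes fin: "energy \<Phi> L f < \<infinity>"
  shows "((\<lambda>\<epsilon>. LINT p:off_diagonal_square L \<epsilon>|lborel. gap p) \<longlongrightarrow> enn2real (energy \<Phi> L f)) (at_right 0)"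
  unfolding tendsto_at_iff_sequentially
proof (intro allI impI)
  let ?S = "{0..<L} \<times> {0..<L}"
  have S [measurable]: "?S \<in> sets (borel :: (real \<times> real) measure)" by (rule square_borel)
  fix X :: "nat \<Rightarrow> real" assume X: "\<forall>i. X i \<in> {0<..} - {0}" "X \<longlonglongrightarrow> 0"
  have "(\<lambda>i. integral\<^sup>L lborel (\<lambda>p. indicator (off_diagonal_square L (X i)) p *\<^sub>R gap p))
      \<longlonglongrightarrow> integral\<^sup>L lborel (\<lambda>p. indicator ?S p *\<^sub>R gap p)"
  proof (rule integral_dominated_convergence)
    show "integrable lborel (\<lambda>p. indicator ?S p *\<^sub>R gap p)"
      using gap_integrable[OF fin] by (simp add: set_integrable_def)
    show "AE p in lborel. norm (indicator (off_diagonal_square L (X i)) p *\<^sub>R gap p) \<le> indicator ?S p *\<^sub>R gap p" for i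
      using gap_nonneg by (intro always_eventually) (auto simp: indicator_def off_diagonal_square_def)
    show "AE p in lborel. (\<lambda>i. indicator (off_diagonal_square L (X i)) p *\<^sub>R gap p) \<longlonglongrightarrow> indicator ?S p *\<^sub>R gap p"
      using AE_lborel_fst_neq_snd
    proof eventually_elim
      case (elim p)
      show ?case
      proof (cases "p \<in> ?S")
        case True
        then have "0 < circle_dist L (fst p) (snd p)"
          using elim by (intro circle_dist_pos) (auto simp: mem_Times_iff)
        with X(2) have "\<forall>\<^sub>F i in sequentially. X i < circle_dist L (fst p) (snd p)"
          by (rule order_tendstoD)
        then have "\<forall>\<^sub>F i in sequentially.
            indicator (off_diagonal_square L (X i)) p *\<^sub>R gap p = indicator ?S p *\<^sub>R gap p"
          by (rule eventually_mono)
            (use True in \<open>auto simp: indicator_def off_diagonal_square_def off_diagonal_def\<close>)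
        then show ?thesis by (rule tendsto_eventually)
      qed (simp add: off_diagonal_square_def)
    qed
  qed measurable
  then show "((\<lambda>\<epsilon>. LINT p:off_diagonal_square L \<epsilon>|lborel. gap p) \<circ> X) \<longlonglongrightarrow> enn2real (energy \<Phi> L f)"
    using gap_integral[OF fin] by (simp add: o_def set_lebesgue_integral_def)
qed

section \<open>The kernel integral off the diagonal and its limit\<close>

lemma kernel_set_integrable:
  assumes "0 < \<epsilon>"
  shows "set_integrable lborel (off_diagonal_square L \<epsilon>) (\<lambda>p. kernel (fst p) (snd p))"
proof -
  \<comment> \<open>A principal value requires integrability for every positive
    \<open>\<epsilon>\<close>, whereas the slicing lemma needs a cut-off below \<open>L / 2\<close>.
    The smaller \<open>\<delta>\<close> gives a larger region.\<close>
  define \<delta> where "\<delta> = min \<epsilon> (L / 3)"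
  have \<delta>: "0 < \<delta>" "\<delta> < L / 2" "\<delta> \<le> \<epsilon>" using assms L_pos by (auto simp: \<delta>_def)
  have "set_integrable lborel (off_diagonal_square L \<delta>) (\<lambda>p. kernel (fst p) (snd p))"
    by (rule set_integrable_off_diagonal[OF \<delta>(1,2) kernel_measurable_borel])
      (use kernel_bound(2)[OF \<delta>(1)] in auto)
  then show ?thesis
    by (rule set_integrable_subset) (use off_diagonal_square_mono[OF \<delta>(3)] in auto)
qed

text \<open>The kernel is the gap, plus \<open>recip\<close> of the circle distance, plus a
  \<open>t\<close>-derivative. The second summand integrates to twice \<open>L\<close> times a
  difference of tails, the third to boundary terms at \<open>s - \<epsilon>\<close> (by periodicity)
  and \<open>s + \<epsilon>\<close>.\<close>

lemma kernel_integral: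
  assumes \<epsilon>: "0 < \<epsilon>" "\<epsilon> < L / 2"
  shows "(LINT p:off_diagonal_square L \<epsilon>|lborel. kernel (fst p) (snd p))
    = (LINT p:off_diagonal_square L \<epsilon>|lborel. gap p)
      + 2 * L * (tail_integral \<Phi> \<epsilon> - tail_integral \<Phi> (L / 2))
      + (LINT s:{0..<L}|lborel. chord_term s (s - \<epsilon>)) - (LINT s:{0..<L}|lborel. chord_term s (s + \<epsilon>))"
proof -
  let ?S = "off_diagonal_square L \<epsilon>"
  let ?h = "\<lambda>p. kernel (fst p) (snd p) - recip (chord (fst p) (snd p))"
  let ?d = "\<lambda>p. recip (circle_dist L (fst p) (snd p))"
  have h_m: "?h \<in> borel_measurable borel" and d_m: "?d \<in> borel_measurable borel"
    unfolding borel_prod[symmetric] by measurable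
  have h_bd: "\<exists>B. \<forall>s t. \<epsilon> \<le> circle_dist L s t \<longrightarrow> \<bar>?h (s, t)\<bar> \<le> B"
    using kernel_bound[OF \<epsilon>(1)] by (intro exI allI impI) (fastforce intro: order_trans[OF abs_triangle_ineq4] add_mono)
  then obtain B where h_bd: "\<And>s t. \<epsilon> \<le> circle_dist L s t \<Longrightarrow> \<bar>?h (s, t)\<bar> \<le> B" by blast
  have d_bd: "\<bar>?d (s, t)\<bar> \<le> recip \<epsilon>" if "\<epsilon> \<le> circle_dist L s t" for s t
    using recip_antimono[OF \<epsilon>(1) that] recip_nonneg by simp
  have h_per: "?h (s, t + L) = ?h (s, t)" and d_per: "?d (s, t + L) = ?d (s, t)" for s t
    by (simp_all add: kernel_periodic f_periodic circle_dist_shift)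
  have h1: "set_integrable lborel ?S ?h" and d1: "set_integrable lborel ?S ?d"
    by (rule set_integrable_off_diagonal[OF \<epsilon>] h_m d_m h_bd d_bd; assumption?)+
  have h2: "(LINT p:?S|lborel. ?h p)
      = (LINT s:{0..<L}|lborel. (LINT t:{s + \<epsilon>..s + L - \<epsilon>}|lborel. ?h (s, t)))"
    by (rule set_integral_off_diagonal[OF \<epsilon> h_m]) (rule h_bd h_per; assumption?)+
  have d2: "(LINT p:?S|lborel. ?d p)
      = (LINT s:{0..<L}|lborel. (LINT t:{s + \<epsilon>..s + L - \<epsilon>}|lborel. ?d (s, t)))"
    by (rule set_integral_off_diagonal[OF \<epsilon> d_m]) (rule d_bd d_per; assumption?)+
  have g: "set_integrable lborel ?S gap"
  proof -
    have "gap = (\<lambda>p. kernel (fst p) (snd p) - ?h p - ?d p)" by (auto simp: gap_def)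
    then show ?thesis
      using kernel_set_integrable[OF \<epsilon>(1)] h1 d1 by (simp only: set_integral_diff)
  qed
  have "(LINT p:?S|lborel. ?d p) = (LINT s:{0..<L}|lborel. 2 * (tail_integral \<Phi> \<epsilon> - tail_integral \<Phi> (L / 2)))"
    unfolding d2 by (simp add: recip_circle_dist_integral[OF \<epsilon>])
  also have "\<dots> = 2 * L * (tail_integral \<Phi> \<epsilon> - tail_integral \<Phi> (L / 2))"
    using L_pos by (simp add: set_integral_const)
  finally have D: "(LINT p:?S|lborel. ?d p) = 2 * L * (tail_integral \<Phi> \<epsilon> - tail_integral \<Phi> (L / 2))" .
  have inner: "(LINT t:{s + \<epsilon>..s + L - \<epsilon>}|lborel. ?h (s, t)) = chord_term s (s - \<epsilon>) - chord_term s (s + \<epsilon>)" for s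
  proof -
    have [measurable]: "(\<lambda>t. ?h (s, t)) \<in> borel_measurable borel" by simp
    have "set_integrable lborel {s + \<epsilon>..s + L - \<epsilon>} (\<lambda>t. ?h (s, t))"
      by (rule set_integrable_lborel_bounded[of _ _ B])
        (use \<epsilon> in \<open>auto intro!: h_bd simp: circle_dist_eq simp del: fst_conv snd_conv\<close>)
    then have "(LINT t:{s + \<epsilon>..s + L - \<epsilon>}|lborel. ?h (s, t)) = chord_term s (s + L - \<epsilon>) - chord_term s (s + \<epsilon>)"
      using kernel_has_integral[OF \<epsilon>, of s] by (simp add: set_borel_integral_eq_integral(2) integral_unique)
    also have "chord_term s (s + L - \<epsilon>) = chord_term s (s - \<epsilon>)"
      using f_periodic[of "s - \<epsilon>"] by (simp add: chord_term_def diff_add_eq)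
    finally show ?thesis .
  qed
  have "(LINT p:?S|lborel. ?h p) = (LINT s:{0..<L}|lborel. chord_term s (s - \<epsilon>) - chord_term s (s + \<epsilon>))"
    unfolding h2 inner ..
  also have "\<dots> = (LINT s:{0..<L}|lborel. chord_term s (s - \<epsilon>)) - (LINT s:{0..<L}|lborel. chord_term s (s + \<epsilon>))"
    using \<epsilon> by (intro set_integral_diff edge_integrable) auto
  finally have H: "(LINT p:?S|lborel. ?h p)
      = (LINT s:{0..<L}|lborel. chord_term s (s - \<epsilon>)) - (LINT s:{0..<L}|lborel. chord_term s (s + \<epsilon>))" .
  have "(LINT p:?S|lborel. kernel (fst p) (snd p)) = (LINT p:?S|lborel. gap p + ?d p + ?h p)"
    by (simp add: gap_def)
  also have "\<dots> = (LINT p:?S|lborel. gap p) + (LINT p:?S|lborel. ?d p) + (LINT p:?S|lborel. ?h p)"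
    using g d1 h1 by (simp add: set_integral_add)
  finally show ?thesis unfolding D H by simp
qed

text \<open>The diverging \<open>2 * L * tail_integral \<Phi> \<epsilon>\<close> is shared equally
  between the two boundary integrals; each pairing tends to zero, and only the gap and the tail from
  \<open>L / 2\<close> remain.\<close>

lemma kernel_limit:
  assumes fin: "energy \<Phi> L f < \<infinity>" and "Lam_condition" "bilipschitz_curve.Lam_condition \<Phi> L (\<lambda>s. f (- s))"
  shows "((\<lambda>\<epsilon>. LINT p:off_diagonal_square L \<epsilon>|lborel. kernel (fst p) (snd p))
    \<longlongrightarrow> enn2real (energy \<Phi> L f) - 2 * L * tail_integral \<Phi> (L / 2)) (at_right 0)"
proof -
  have "((\<lambda>\<epsilon>. (LINT p:off_diagonal_square L \<epsilon>|lborel. gap p) - 2 * L * tail_integral \<Phi> (L / 2)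
        + (L * tail_integral \<Phi> \<epsilon> - (LINT s:{0..<L}|lborel. chord_term s (s + \<epsilon>)))
        + (L * tail_integral \<Phi> \<epsilon> + (LINT s:{0..<L}|lborel. chord_term s (s - \<epsilon>))))
      \<longlongrightarrow> enn2real (energy \<Phi> L f) - 2 * L * tail_integral \<Phi> (L / 2) + 0 + 0) (at_right 0)"
    by (intro tendsto_intros gap_limit right_edge_limit left_edge_limit assms)
  moreover have "\<forall>\<^sub>F \<epsilon> in at_right 0.
      (LINT p:off_diagonal_square L \<epsilon>|lborel. gap p) - 2 * L * tail_integral \<Phi> (L / 2)
        + (L * tail_integral \<Phi> \<epsilon> - (LINT s:{0..<L}|lborel. chord_term s (s + \<epsilon>)))
        + (L * tail_integral \<Phi> \<epsilon> + (LINT s:{0..<L}|lborel. chord_term s (s - \<epsilon>)))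
      = (LINT p:off_diagonal_square L \<epsilon>|lborel. kernel (fst p) (snd p))"
    unfolding eventually_at_right_field
    by (intro exI[of _ "L / 2"]) (use L_pos in \<open>auto simp: kernel_integral algebra_simps\<close>)
  ultimately show ?thesis using tendsto_cong by force
qed

text \<open>For a nonnegative kernel the cut-off integrands increase as the strip shrinks, and their
  integrals converge by \<open>kernel_limit\<close>. Monotone convergence then yields integrability
  and the value together.\<close>

lemma
  assumes fin: "energy \<Phi> L f < \<infinity>" and "Lam_condition" "bilipschitz_curve.Lam_condition \<Phi> L (\<lambda>s. f (- s))"
    and nonneg: "AE p in lborel. p \<in> {0..<L} \<times> {0..<L} \<longrightarrow> 0 \<le> kernel (fst p) (snd p)"
  shows kernel_integrable: "set_integrable lborel ({0..<L} \<times> {0..<L}) (\<lambda>p. kernel (fst p) (snd p))"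
    and kernel_integral_square: "(LINT p:{0..<L} \<times> {0..<L}|lborel. kernel (fst p) (snd p))
      = enn2real (energy \<Phi> L f) - 2 * L * tail_integral \<Phi> (L / 2)"
proof -
  let ?S = "{0..<L} \<times> {0..<L}"
  let ?u = "\<lambda>n p. indicator (off_diagonal_square L (inverse (real (Suc n)))) p *\<^sub>R kernel (fst p) (snd p)"
  have S [measurable]: "?S \<in> sets (borel :: (real \<times> real) measure)" by (rule square_borel)
  note kernel_measurable_borel [measurable]
  have pos: "0 < inverse (real (Suc n))" for n by simp
  have lim0: "(\<lambda>n. inverse (real (Suc n))) \<longlonglongrightarrow> 0" by (rule LIMSEQ_inverse_real_of_nat)
  have i: "integrable lborel (?u n)" for n
    using kernel_set_integrable[OF pos] by (simp add: set_integrable_def)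
  have mono: "AE p in lborel. mono (\<lambda>n. ?u n p)"
    using nonneg
  proof eventually_elim
    case (elim p)
    show ?case
    proof (rule monoI)
      fix m n :: nat assume "m \<le> n"
      then have "inverse (real (Suc n)) \<le> inverse (real (Suc m))" by (simp add: divide_simps)
      from off_diagonal_square_mono[OF this, of L] elim
      show "?u m p \<le> ?u n p" by (auto simp: indicator_def off_diagonal_square_def)
    qed
  qed
  have nn: "AE p in lborel. 0 \<le> ?u n p" for n
    using nonneg by (rule eventually_mono) (auto simp: indicator_def off_diagonal_square_def)
  have lim: "AE p in lborel. (\<lambda>n. ?u n p) \<longlonglongrightarrow> indicator ?S p *\<^sub>R kernel (fst p) (snd p)"
    using AE_lborel_fst_neq_snd
  proof eventually_elim
    case (elim p)
    show ?case
    proof (cases "p \<in> ?S")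
      case True
      then have "0 < circle_dist L (fst p) (snd p)"
        using elim by (intro circle_dist_pos) (auto simp: mem_Times_iff)
      with lim0 have "\<forall>\<^sub>F n in sequentially. inverse (real (Suc n)) < circle_dist L (fst p) (snd p)"
        by (rule order_tendstoD)
      then have "\<forall>\<^sub>F n in sequentially. ?u n p = indicator ?S p *\<^sub>R kernel (fst p) (snd p)"
        by (rule eventually_mono)
          (use True in \<open>auto simp: indicator_def off_diagonal_square_def off_diagonal_def\<close>)
      then show ?thesis by (rule tendsto_eventually)
    qed (simp add: off_diagonal_square_def)
  qed
  have "filterlim (\<lambda>n. inverse (real (Suc n))) (at_right 0) sequentially"
    using lim0 by (auto simp: filterlim_at intro!: always_eventually)
  from filterlim_compose[OF kernel_limit[OF assms(1-3)] this]
  have ilim: "(\<lambda>n. integral\<^sup>L lborel (?u n)) \<longlonglongrightarrow> enn2real (energy \<Phi> L f) - 2 * L * tail_integral \<Phi> (L / 2)"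
    by (simp add: set_lebesgue_integral_def)
  have u: "(\<lambda>p. indicator ?S p *\<^sub>R kernel (fst p) (snd p)) \<in> borel_measurable lborel"
    by measurable
  note * = integral_monotone_convergence_nonneg[OF i mono nn lim ilim u]
  show "set_integrable lborel ?S (\<lambda>p. kernel (fst p) (snd p))"
    and "(LINT p:?S|lborel. kernel (fst p) (snd p)) = enn2real (energy \<Phi> L f) - 2 * L * tail_integral \<Phi> (L / 2)"
    using * by (simp_all add: set_integrable_def set_lebesgue_integral_def)
qed

section \<open>Identification of the kernel with the angle integrands\<close>

lemma kernel_eq:
  assumes "regular_point s" "regular_point t" "f s \<noteq> f t"
  shows "((1 - Theta \<Phi> (chord s t)) * (1 - cos (phi_angle f s t))
          + Theta \<Phi> (chord s t) * (1 - cos (psi_angle f s t))) / \<Phi> (chord s t) = kernel s t"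
proof -
  have r: "0 < chord s t" using assms(3) by simp
  have \<Phi>: "0 < \<Phi> (chord s t)" by (rule Phi_pos[OF r])
  have 1: "cos (phi_angle f s t) = - (vel s \<bullet> vel t) + 2 * (vel s \<bullet> direction s t) * (vel t \<bullet> direction s t)"
    unfolding phi_angle_def direction_def using assms
    by (subst cos_conformal_angle) (auto simp: regular_point_def sgn_div_norm inverse_eq_divide)
  have 2: "cos (psi_angle f s t) = vel s \<bullet> vel t"
    unfolding psi_angle_def using assms by (subst cos_vec_angle) (auto simp: regular_point_def)
  show "((1 - Theta \<Phi> (chord s t)) * (1 - cos (phi_angle f s t))
          + Theta \<Phi> (chord s t) * (1 - cos (psi_angle f s t))) / \<Phi> (chord s t) = kernel s t"
    unfolding 1 2 kernel_def recip_def Theta_def using r \<Phi> by (simp add: field_simps)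
qed

text \<open>The hypothesis says \<open>\<Phi> * Lam \<ge> -1\<close> at the chord length, and
  \<open>Lam\<close> is nonpositive, so \<open>Theta\<close> lies between 0 and 1. The quantity
  under \<open>arccos\<close> is thus a convex combination of two cosines.\<close>

lemma
  assumes reg: "regular_point s" "regular_point t" "f s \<noteq> f t"
    and le: "0 \<le> 1 / \<Phi> (chord s t) + Lam \<Phi> (chord s t)"
  shows phi_Phi_cos_range: "phi_Phi_cos \<Phi> f s t \<in> {-1..1}"
    and phi_Phi_eq: "(1 - cos (phi_Phi \<Phi> f s t)) / \<Phi> (chord s t) = kernel s t"
    and kernel_nonneg: "0 \<le> kernel s t"
proof -
  let ?\<theta> = "Theta \<Phi> (chord s t)"
  have r: "0 < chord s t" using reg by simp
  have \<Phi>: "0 < \<Phi> (chord s t)" by (rule Phi_pos[OF r])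
  have "0 \<le> \<Phi> (chord s t) * (1 / \<Phi> (chord s t) + Lam \<Phi> (chord s t))"
    using \<Phi> le by (intro mult_nonneg_nonneg) auto
  then have \<theta>0: "0 \<le> ?\<theta>" using \<Phi> by (simp add: Theta_def distrib_left)
  have \<theta>1: "?\<theta> \<le> 1"
    using mult_nonneg_nonpos[of "\<Phi> (chord s t)" "Lam \<Phi> (chord s t)"] \<Phi> Lam_nonpos[of "chord s t"]
    by (simp add: Theta_def)
  have "phi_Phi_cos \<Phi> f s t \<le> (1 - ?\<theta>) * 1 + ?\<theta> * 1" "(1 - ?\<theta>) * (-1) + ?\<theta> * (-1) \<le> phi_Phi_cos \<Phi> f s t"
    unfolding phi_Phi_cos_def using \<theta>0 \<theta>1 by (intro add_mono mult_left_mono; simp)+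
  then show range: "phi_Phi_cos \<Phi> f s t \<in> {-1..1}" by simp
  then have "1 - cos (phi_Phi \<Phi> f s t) = 1 - phi_Phi_cos \<Phi> f s t"
    by (simp add: phi_Phi_def cos_arccos)
  also have "\<dots> = (1 - ?\<theta>) * (1 - cos (phi_angle f s t)) + ?\<theta> * (1 - cos (psi_angle f s t))"
    by (simp add: phi_Phi_cos_def algebra_simps)
  finally show eq: "(1 - cos (phi_Phi \<Phi> f s t)) / \<Phi> (chord s t) = kernel s t"
    using kernel_eq[OF reg] by simp
  show "0 \<le> kernel s t" unfolding eq[symmetric] using \<Phi> by simp
qed

text \<open>A chord is at most half the length of the curve, so almost every chord length falls in
  the interval over which the extra hypothesis takes its infimum.\<close>

lemma AE_regular_pair:
  "AE p in lborel. p \<in> {0..<L} \<times> {0..<L} \<longrightarrow> regular_point (fst p) \<and> regular_point (snd p)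
    \<and> f (fst p) \<noteq> f (snd p) \<and> chord (fst p) (snd p) \<in> {0<..L / 2}"
  using AE_lborel_fst_snd[OF AE_regular] AE_lborel_fst_neq_snd
proof eventually_elim
  case (elim p)
  show ?case
  proof
    assume "p \<in> {0..<L} \<times> {0..<L}"
    then have p: "fst p \<in> {0..<L}" "snd p \<in> {0..<L}" by auto
    have "0 < chord (fst p) (snd p)" by (rule chord_pos[OF circle_dist_pos[OF p elim(2)]])
    moreover have "chord (fst p) (snd p) \<le> L / 2" by (rule chord_le_half) (use p in auto)
    ultimately show "regular_point (fst p) \<and> regular_point (snd p)
      \<and> f (fst p) \<noteq> f (snd p) \<and> chord (fst p) (snd p) \<in> {0<..L / 2}"
      using elim(1) by auto
  qed
qed

end

theorem theorem2p1:
  fixes L :: real and \<Phi> :: "real \<Rightarrow> real" and f :: "real \<Rightarrow> real ^ 'n"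
  assumes L_pos: "L > 0"
    and n_ge_2: "CARD('n) \<ge> 2"
    and Phi_pos: "\<forall>x>0. \<Phi> x > 0"
    and A1: "mono_on {0<..} \<Phi>"
    and A2: "\<forall>x>0. set_integrable lebesgue {x..} (\<lambda>t. 1 / \<Phi> t)"
    and A3: "\<forall>g :: real \<Rightarrow> real ^ 'n.
        arclength_closed_curve L g \<and> energy \<Phi> L g < \<infinity>
        \<longrightarrow> W_Phi \<Phi> L g \<and> W1inf L g \<and> bi_lipschitz_curve L g"
    and A4: "\<forall>g :: real \<Rightarrow> real ^ 'n.
        W_Phi \<Phi> L g \<and> W1inf L g \<and> bi_lipschitz_curve L g \<and> unit_speed g
        \<longrightarrow>
          ((\<lambda>\<epsilon>. \<epsilon> * (LINT s|circle_measure L.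
              Lam \<Phi> (norm (g s - g (s + \<epsilon>))) - Lam \<Phi> \<epsilon>)) \<longlongrightarrow> 0) (at_right 0)
        \<and> ((\<lambda>\<epsilon>. LINT s1|circle_measure L.
              Lam \<Phi> (norm (g s1 - g (s1 + \<epsilon>))) *
              (LINT s2:{s1..s1 + \<epsilon>}|lebesgue. (norm (tangent g s1 - tangent g s2))\<^sup>2))
            \<longlongrightarrow> 0) (at_right 0)"
    and curve: "arclength_closed_curve L f"
    and finite_energy: "energy \<Phi> L f < \<infinity>"
  shows "(\<exists>V. has_pv_integral L
            (\<lambda>(s1, s2).
               ((1 - Theta \<Phi> (norm (f s1 - f s2))) * (1 - cos (phi_angle f s1 s2))
                + Theta \<Phi> (norm (f s1 - f s2)) * (1 - cos (psi_angle f s1 s2)))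
               / \<Phi> (norm (f s1 - f s2))) V
          \<and> enn2real (energy \<Phi> L f) = V + 2 * L * tail_integral \<Phi> (L / 2))
    \<and> (0 \<le> (INF x\<in>{0<..L / 2}. ereal (1 / \<Phi> x + Lam \<Phi> x))
        \<longrightarrow>
          (AE (s1, s2) in torus_measure L. phi_Phi_cos \<Phi> f s1 s2 \<in> {-1..1})
        \<and> integrable (torus_measure L)
            (\<lambda>(s1, s2). (1 - cos (phi_Phi \<Phi> f s1 s2)) / \<Phi> (norm (f s1 - f s2)))
        \<and> enn2real (energy \<Phi> L f) =
            (LINT (s1, s2)|torus_measure L.
               (1 - cos (phi_Phi \<Phi> f s1 s2)) / \<Phi> (norm (f s1 - f s2)))
            + 2 * L * tail_integral \<Phi> (L / 2))"
proof -
  interpret energy_weight \<Phi>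
    by unfold_locales (use Phi_pos A1 A2 in auto)
  interpret arclength_curve L f
    by unfold_locales (use L_pos curve in auto)
  from A3 curve finite_energy have f: "W_Phi \<Phi> L f" "W1inf L f" "bi_lipschitz_curve L f" by auto
  from f(3) obtain c where c: "0 < c" "\<And>s t. c * circle_dist L s t \<le> norm (f s - f t)"
    unfolding bi_lipschitz_curve_def dist_norm by blast
  interpret bilipschitz_curve \<Phi> L f c
    by unfold_locales (use c in auto)
  interpret rev: bilipschitz_curve \<Phi> L "\<lambda>s. f (- s)" c by (rule reversed_bilipschitz_curve)
  have "unit_speed f" using curve by (simp add: arclength_closed_curve_def)
  with A4 f have cond: "Lam_condition" unfolding Lam_condition_def by blast
  have rev_energy: "energy \<Phi> L (\<lambda>s. f (- s)) < \<infinity>" using finite_energy by (simp add: energy_reversed)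
  have "unit_speed (\<lambda>s. f (- s))" using rev.curve by (simp add: arclength_closed_curve_def)
  \<comment> \<open>(A.3) and (A.4) range over all curves, so the reversed curve also satisfies the
    two limits; these handle the boundary terms at \<open>s - \<epsilon>\<close>.\<close>
  with A4 A3[rule_format, OF conjI[OF rev.curve rev_energy]] have rev_cond: "rev.Lam_condition"
    unfolding rev.Lam_condition_def by blast
  let ?V = "enn2real (energy \<Phi> L f) - 2 * L * tail_integral \<Phi> (L / 2)"
  let ?g = "\<lambda>(s1, s2). ((1 - Theta \<Phi> (norm (f s1 - f s2))) * (1 - cos (phi_angle f s1 s2))
                + Theta \<Phi> (norm (f s1 - f s2)) * (1 - cos (psi_angle f s1 s2)))
               / \<Phi> (norm (f s1 - f s2))"
  have g: "AE p in lborel. p \<in> {0..<L} \<times> {0..<L} \<longrightarrow> ?g p = kernel (fst p) (snd p)"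
    using AE_regular_pair by (rule eventually_mono) (unfold split_def, blast intro: kernel_eq)
  have "has_pv_integral L ?g ?V"
    unfolding has_pv_integral_def set_integrable_torus_off_diagonal[OF kernel_measurable_borel g]
      set_integral_torus_off_diagonal[OF kernel_measurable_borel g]
    using kernel_set_integrable kernel_limit[OF finite_energy cond rev_cond] by blast
  then have part1: "\<exists>V. has_pv_integral L ?g V
      \<and> enn2real (energy \<Phi> L f) = V + 2 * L * tail_integral \<Phi> (L / 2)"
    by (intro exI[of _ ?V]) simp
  let ?k = "\<lambda>(s1, s2). (1 - cos (phi_Phi \<Phi> f s1 s2)) / \<Phi> (norm (f s1 - f s2))"
  have part2: "(AE (s1, s2) in torus_measure L. phi_Phi_cos \<Phi> f s1 s2 \<in> {-1..1})
      \<and> integrable (torus_measure L) ?k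
      \<and> enn2real (energy \<Phi> L f) = integral\<^sup>L (torus_measure L) ?k + 2 * L * tail_integral \<Phi> (L / 2)"
    if inf: "0 \<le> (INF x\<in>{0<..L / 2}. ereal (1 / \<Phi> x + Lam \<Phi> x))"
  proof -
    \<comment> \<open>An infimum in the extended reals is a lower bound for each member without any
      boundedness condition.\<close>
    have "0 \<le> 1 / \<Phi> x + Lam \<Phi> x" if "x \<in> {0<..L / 2}" for x
      using order_trans[OF inf INF_lower[OF that]] by simp
    then have AE: "AE p in lborel. p \<in> {0..<L} \<times> {0..<L} \<longrightarrow> regular_point (fst p) \<and> regular_point (snd p)
        \<and> f (fst p) \<noteq> f (snd p) \<and> 0 \<le> 1 / \<Phi> (chord (fst p) (snd p)) + Lam \<Phi> (chord (fst p) (snd p))"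
      using AE_regular_pair by (auto elim!: eventually_mono)
    have k: "AE p in lborel. p \<in> {0..<L} \<times> {0..<L} \<longrightarrow> ?k p = kernel (fst p) (snd p)"
      using AE by (rule eventually_mono) (unfold split_def, blast intro: phi_Phi_eq)
    have nn: "AE p in lborel. p \<in> {0..<L} \<times> {0..<L} \<longrightarrow> 0 \<le> kernel (fst p) (snd p)"
      using AE by (rule eventually_mono) (blast intro: kernel_nonneg)
    note square = kernel_integrable[OF finite_energy cond rev_cond nn]
      kernel_integral_square[OF finite_energy cond rev_cond nn]
    note transfer = kernel_measurable_borel square_borel k
    have "AE p in lborel. p \<in> {0..<L} \<times> {0..<L} \<longrightarrow> phi_Phi_cos \<Phi> f (fst p) (snd p) \<in> {-1..1}"
      using AE by (rule eventually_mono) (blast intro: phi_Phi_cos_range)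
    then have "AE p in lebesgue. p \<in> {0..<L} \<times> {0..<L} \<longrightarrow> phi_Phi_cos \<Phi> f (fst p) (snd p) \<in> {-1..1}"
      by (rule AE_completion)
    moreover have "{0..<L} \<times> {0..<L} \<inter> space lebesgue \<in> sets lebesgue"
      using square_borel by simp
    ultimately have "AE p in torus_measure L. phi_Phi_cos \<Phi> f (fst p) (snd p) \<in> {-1..1}"
      by (simp only: AE_restrict_space_iff)
    then have "AE (s1, s2) in torus_measure L. phi_Phi_cos \<Phi> f s1 s2 \<in> {-1..1}"
      by (simp only: split_def)
    moreover have "integrable (torus_measure L) ?k"
      unfolding integrable_lebesgue_on_AE_borel[OF transfer] by (rule square(1))
    moreover have "integral\<^sup>L (torus_measure L) ?k = ?V"
      unfolding integral_lebesgue_on_AE_borel[OF transfer] by (rule square(2))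
    ultimately show ?thesis by simp
  qed
  show ?thesis using part1 part2 by blast
qed

end
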